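(* Let $n\ge1$, let $F\in\mathbb{K}_{\mathbb{R}}[x_1,\dots,x_{n+1}]$ be a real polynomial such that $F_t$ is completely non-degenerate for all sufficiently small $t>0$, and let $f=\mathrm{Trop}(F)$ be its tropicalisation. Then $$\frac{\sigma_{2n}}{\sigma_n}\int_{V^{\mathbb{R}}(f)}|k|\;\le\;\int_{V(f)}|K| .$$
   Context: Constants: $\sigma_m$ is the volume of the unit sphere $S^m\subset\mathbb{R}^{m+1}$, and $a_n=\pi\,\sigma_{2n}/\sigma_{2n+1}$; $ds$ is the canonical volume form on $\mathbb{RP}^n$, with $\mathrm{vol}(\mathbb{RP}^n)=\sigma_n/2$, and $\mathrm{vol}(\mathbb{CP}^n)=\sigma_{2n+1}/\sigma_1$. $\mathbb{K}$ is the field of locally convergent generalised Puiseux series $\xi(t)=\sum_{r\in R}\beta_r t^r$ ($R\subset\mathbb{R}$ well-ordered, $\beta_r\in\mathbb{C}$, convergent for small $t>0$); $\mathbb{K}_{\mathbb{R}}\subset\mathbb{K}$ is the subfield of series with real coefficients; $\mathrm{val}(\xi)=-\min\{r:\beta_r\ne0\}$ for $\xi\neq0$. For $F=\sum_\alpha c_\alpha x^\alpha\in\mathbb{K}[x_1,\dots,x_{n+1}]$, $F_t$ is the complex polynomial obtained by evaluating the coefficients at small $t>0$, and $\mathrm{Trop}(F)(X)=\max_\alpha\{\mathrm{val}(c_\alpha)+X\cdot\alpha\}$ (max over exponents with $c_\alpha\ne0$), with Newton polytope $\triangle_f=\triangle_F$. $V(f)\subset\mathbb{R}^{n+1}$ is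 the set of points where the maximum is attained at least twice. A complex polynomial $G$ is completely non-degenerate if for every (not necessarily proper) face $\delta$ of its Newton polytope the truncation $G^\delta$ (monomials with exponents in $\delta$) defines a non-singular variety in $(\mathbb{C}^* )^{n+1}$. Real total curvature: for $F_t\in\mathbb{R}[x_1,\dots,x_{n+1}]$ let $\mathbb{R}V(F_t)$ be the zero set in $(\mathbb{R}^* )^{n+1}$, $\gamma_t^{\mathbb{R}}:\mathbb{R}V(F_t)\to\mathbb{RP}^n$, $x\mapsto[x_i\,\partial F_t/\partial x_i]_{i=1}^{n+1}$ the logarithmic Gauss map, and $\mathcal{A}^{\mathbb{R}}(F_t)$ the real amoeba (image of $\mathbb{R}V(F_t)$ under $x\mapsto(\log_t|x_i|)_i$), whose total curvature is $\int_{\mathcal{A}^{\mathbb{R}}(F_t)}|k|=\int_{\mathbb{RP}^n}\#(\gamma_t^{\mathbb{R}})^{-1}(\beta)\,ds$. Then $$\int_{V^{\mathbb{R}}(f)}|k|:=\limsup_{t\to0^+}\int_{\mathcal{A}^{\mathbb{R}}(F_t)}|k| .$$ Complex total curvature: $\int_{V(f)}K:=(-1)^n a_n\,(n+1)!\,\mathrm{vol}(\triangle_f)\,\mathrm{vol}(\mathbb{CP}^n)$ (which equals $(-1)^na_n\int_{\mathbb{CP}^n}\#\gamma_t^{-1}(\beta)\,dp$, $\gamma_t$ the complex logarithmic Gauss map on the zero set of $F_t$ in $(\mathbb{C}^* )^{n+1}$ and $dp$ the canonical volume form, for any completely non-degenerate $F_t$ realising $f$, $t>0$ small), and $\int_{V(f)}|K|=(-1)^n\int_{V(f)}K$.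 *)

theory Defs
  imports "HOL-Analysis.Analysis" "HOL-Library.Poly_Mapping"
begin

section \<open>Locally convergent generalised Puiseux series\<close>

text \<open>
  The coefficients range over \<open>'a\<close>: the field \<open>K\<close> is \<open>complex gpuiseux\<close>, and its subfield
  \<open>K\<^sub>R\<close> is \<open>real gpuiseux\<close>.  A support of order type greater than \<open>\<omega>\<close> carries no canonical
  enumeration, so convergence means unordered (that is, absolute) summability.
\<close>

typedef (overloaded) ('a::real_normed_field) gpuiseux =
  "{\<beta> :: real \<Rightarrow> 'a. wfp_on {r. \<beta> r \<noteq> 0} (<) \<and>
     (\<forall>\<^sub>F t in at_right (0::real). (\<lambda>r. (t powr r) *\<^sub>R \<beta> r) summable_on UNIV)}"
  morphisms gp_coeff Abs_gpuiseux
  by (rule exI[of _ "\<lambda>_. 0"]) (simp add: wfp_on_def)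

setup_lifting type_definition_gpuiseux

instantiation gpuiseux :: (real_normed_field) zero
begin
lift_definition zero_gpuiseux :: "'a gpuiseux" is "\<lambda>_. 0"
  by (simp add: wfp_on_def)
instance ..
end

definition gp_eval :: "'a::real_normed_field gpuiseux \<Rightarrow> real \<Rightarrow> 'a" where
  "gp_eval \<xi> t = (\<Sum>\<^sub>\<infinity>r. (t powr r) *\<^sub>R gp_coeff \<xi> r)"

text \<open>Only meaningful for \<open>\<xi> \<noteq> 0\<close>; the minimum exists because the support is well-ordered.\<close>

definition gp_val :: "'a::real_normed_field gpuiseux \<Rightarrow> real" where
  "gp_val \<xi> = - (LEAST r. gp_coeff \<xi> r \<noteq> 0)"


section \<open>Polynomials\<close>

text \<open>Polynomials in variables indexed by \<open>'n\<close>, as finitely supported functions on exponents.\<close>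

type_synonym ('n, 'a) mpoly = "(nat ^ 'n) \<Rightarrow>\<^sub>0 'a"

definition mp_eval :: "('n::finite, 'a::comm_semiring_1) mpoly \<Rightarrow> 'a ^ 'n \<Rightarrow> 'a" where
  "mp_eval G x =
     (\<Sum>\<alpha>\<in>Poly_Mapping.keys G. Poly_Mapping.lookup G \<alpha> * (\<Prod>i\<in>UNIV. (x $ i) ^ (\<alpha> $ i)))"

text \<open>
  The truncated subtraction in the exponent is harmless: the coefficient vanishes if \<open>\<alpha> $ i = 0\<close>.
\<close>

definition mp_partial :: "'n \<Rightarrow> ('n::finite, 'a::comm_semiring_1) mpoly \<Rightarrow> ('n, 'a) mpoly" where
  "mp_partial i G =
     (\<Sum>\<alpha>\<in>Poly_Mapping.keys G.
        Poly_Mapping.single (\<alpha> - axis i 1) (of_nat (\<alpha> $ i) * Poly_Mapping.lookup G \<alpha>))"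

definition mp_at :: "('n, 'a::real_normed_field gpuiseux) mpoly \<Rightarrow> real \<Rightarrow> ('n, 'a) mpoly" where
  "mp_at F t = Poly_Mapping.map (\<lambda>\<xi>. gp_eval \<xi> t) F"

definition mp_complexify :: "('n, real) mpoly \<Rightarrow> ('n, complex) mpoly" where
  "mp_complexify G = Poly_Mapping.map complex_of_real G"

definition exponent_point :: "nat ^ 'n \<Rightarrow> real ^ 'n" where
  "exponent_point \<alpha> = (\<chi> i. real (\<alpha> $ i))"

definition newton_polytope :: "('n::finite, 'a::zero) mpoly \<Rightarrow> (real ^ 'n) set" where
  "newton_polytope G = convex hull (exponent_point ` Poly_Mapping.keys G)"

definition truncation ::
    "('n, 'a::zero) mpoly \<Rightarrow> (real ^ 'n) set \<Rightarrow> ('n, 'a) mpoly" where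
  "truncation G \<delta> = Poly_Mapping.mapp (\<lambda>\<alpha> c. if exponent_point \<alpha> \<in> \<delta> then c else 0) G"

definition alg_torus :: "('a::zero ^ 'n) set" where
  "alg_torus = {x. \<forall>i. x $ i \<noteq> 0}"

text \<open>Non-singularity of the (possibly empty) hypersurface in the scheme-theoretic sense.\<close>

definition nonsingular_in_torus :: "('n::finite, complex) mpoly \<Rightarrow> bool" where
  "nonsingular_in_torus G \<longleftrightarrow>
     \<not> (\<exists>x\<in>alg_torus. mp_eval G x = 0 \<and> (\<forall>i. mp_eval (mp_partial i G) x = 0))"

text \<open>
  For \<^const>\<open>face_of\<close> the empty set is a face of every polytope.  The truncation to it is the zero
  polynomial, so it has to be excluded, except as the improper face of the empty polytope: this
  makes the zero polynomial degenerate.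
\<close>

definition completely_nondegenerate :: "('n::finite, complex) mpoly \<Rightarrow> bool" where
  "completely_nondegenerate G \<longleftrightarrow>
     (\<forall>\<delta>. \<delta> face_of newton_polytope G \<and> (\<delta> \<noteq> {} \<or> \<delta> = newton_polytope G) \<longrightarrow>
        nonsingular_in_torus (truncation G \<delta>))"


section \<open>Tropical polynomials\<close>

text \<open>
  A tropical polynomial is kept as a formal object: \<open>f \<alpha> = None\<close> encodes the coefficient
  \<open>-\<infinity>\<close>, and the Newton polytope is the convex hull of the exponents that occur.
\<close>

type_synonym 'n trop_poly = "nat ^ 'n \<rightharpoonup> real"

definition Trop :: "('n, 'a::real_normed_field gpuiseux) mpoly \<Rightarrow> 'n trop_poly" where
  "Trop F = (\<lambda>\<alpha>. if Poly_Mapping.lookup F \<alpha> = 0 then None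
                  else Some (gp_val (Poly_Mapping.lookup F \<alpha>)))"

definition trop_eval :: "('n::finite) trop_poly \<Rightarrow> real ^ 'n \<Rightarrow> real" where
  "trop_eval f X = Max ((\<lambda>\<alpha>. the (f \<alpha>) + X \<bullet> exponent_point \<alpha>) ` dom f)"

definition trop_hypersurface :: "('n::finite) trop_poly \<Rightarrow> (real ^ 'n) set" where
  "trop_hypersurface f =
     {X. \<exists>\<alpha>\<in>dom f. \<exists>\<alpha>'\<in>dom f. \<alpha> \<noteq> \<alpha>' \<and>
        the (f \<alpha>) + X \<bullet> exponent_point \<alpha> = trop_eval f X \<and>
        the (f \<alpha>') + X \<bullet> exponent_point \<alpha>' = trop_eval f X}"

definition trop_newton_polytope :: "('n::finite) trop_poly \<Rightarrow> (real ^ 'n) set" where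
  "trop_newton_polytope f = convex hull (exponent_point ` dom f)"


section \<open>Volumes of spheres and projective spaces\<close>

text \<open>
  The volume of the unit sphere in \<open>R\<^bsup>m+1\<^esup>\<close> is \<open>m + 1\<close> times the volume of the unit ball.
\<close>

definition sphere_vol :: "nat \<Rightarrow> real" where
  "sphere_vol m = real (m + 1) * unit_ball_vol (real (m + 1))"

definition CP_vol :: "nat \<Rightarrow> real" where
  "CP_vol n = sphere_vol (2 * n + 1) / sphere_vol 1"

definition curv_const :: "nat \<Rightarrow> real" where
  "curv_const n = pi * sphere_vol (2 * n) / sphere_vol (2 * n + 1)"

text \<open>
  Surface measure of the unit sphere by polar coordinates: the area of \<open>A\<close> is the dimension of the
  ambient space times the volume of the cone \<open>{r x | 0 < r \<le> 1, x \<in> A}\<close>.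
\<close>

definition sphere_measure :: "('a::euclidean_space) measure" where
  "sphere_measure =
     scale_measure (of_nat DIM('a))
       (distr (restrict_space lborel (cball 0 1 - {0})) (restrict_space borel (sphere 0 1)) sgn)"

text \<open>
  Real projective space is the set of lines through the origin of \<open>real ^ 'n\<close>, with the quotient
  \<open>\<sigma>\<close>-algebra of the sphere.  The quotient map is a two-to-one local isometry, whence the factor
  \<open>1 / 2\<close> in the canonical volume.
\<close>

definition RP :: "(real ^ 'n::finite) set set" where
  "RP = {L. subspace L \<and> dim L = 1}"

definition RP_algebra :: "(real ^ 'n::finite) set measure" where
  "RP_algebra = sigma RP
     {A. A \<subseteq> RP \<and> {x \<in> sphere 0 1. span {x} \<in> A} \<in> sets (restrict_space borel (sphere 0 1))}"

definition RP_measure :: "(real ^ 'n::finite) set measure" where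
  "RP_measure = scale_measure (1 / 2) (distr sphere_measure RP_algebra (\<lambda>x. span {x}))"

lemma sphere_vol_0: "sphere_vol 0 = 2"
  using unit_ball_vol_odd[of 0] by (simp add: sphere_vol_def)

lemma sphere_vol_1: "sphere_vol 1 = 2 * pi"
  using unit_ball_vol_even[of 1] by (simp add: sphere_vol_def)

lemma space_sphere_measure: "space (sphere_measure :: 'a::euclidean_space measure) = sphere 0 1"
  by (simp add: sphere_measure_def space_scale_measure space_restrict_space)

lemma emeasure_sphere_measure_space:
  "emeasure (sphere_measure :: 'a::euclidean_space measure) (sphere 0 1) =
     ennreal (sphere_vol (DIM('a) - 1))"
proof -
  let ?B = "cball (0::'a) 1 - {0}"
  let ?M = "restrict_space lborel ?B"
  let ?N = "restrict_space borel (sphere (0::'a) 1)"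
  have "sgn \<in> measurable ?M ?N"
  proof (rule measurable_restrict_space2)
    show "sgn \<in> space ?M \<rightarrow> sphere 0 1"
      by (auto simp: space_restrict_space norm_sgn)
    have "(sgn :: 'a \<Rightarrow> 'a) = (\<lambda>x. (1 / norm x) *\<^sub>R x)"
      by (auto simp: sgn_div_norm divide_inverse)
    then have "(sgn :: 'a \<Rightarrow> 'a) \<in> measurable lborel borel"
      by simp
    then show "sgn \<in> measurable ?M borel"
      by (rule measurable_restrict_space1)
  qed
  moreover have "sgn -` sphere 0 1 \<inter> space ?M = ?B"
    by (auto simp: space_restrict_space norm_sgn)
  moreover have "sphere (0::'a) 1 \<in> sets ?N"
    using sets.top[of ?N] by (simp add: space_restrict_space)
  ultimately have "emeasure (distr ?M ?N sgn) (sphere 0 1) = emeasure ?M ?B"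
    by (simp add: emeasure_distr)
  also have "\<dots> = emeasure lborel (cball (0::'a) 1)"
    by (subst emeasure_restrict_space) (auto simp: emeasure_Diff)
  also have "\<dots> = ennreal (unit_ball_vol (real DIM('a)))"
    by (simp add: emeasure_cball)
  finally show ?thesis
    by (simp add: sphere_measure_def sphere_vol_def ennreal_of_nat_eq_real_of_nat ennreal_mult)
qed

lemma span_singleton_in_RP: "x \<in> sphere 0 1 \<Longrightarrow> span {x :: real ^ 'n::finite} \<in> RP"
  by (auto simp: RP_def dim_span dim_singleton)

lemma space_RP_algebra: "space (RP_algebra :: (real ^ 'n::finite) set measure) = RP"
  by (auto simp: RP_algebra_def space_measure_of_conv)

lemma space_RP_measure: "space (RP_measure :: (real ^ 'n::finite) set measure) = RP"
  by (simp add: RP_measure_def space_scale_measure space_RP_algebra)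

lemma measurable_span_RP:
  "(\<lambda>x. span {x}) \<in> measurable sphere_measure (RP_algebra :: (real ^ 'n::finite) set measure)"
  unfolding RP_algebra_def
proof (rule measurable_measure_of)
  show "(\<lambda>x. span {x}) \<in> space sphere_measure \<rightarrow> RP"
    using span_singleton_in_RP by (auto simp: space_sphere_measure)
next
  fix A :: "(real ^ 'n) set set"
  assume "A \<in> {A. A \<subseteq> RP \<and>
    {x \<in> sphere 0 1. span {x} \<in> A} \<in> sets (restrict_space borel (sphere 0 1))}"
  moreover have "(\<lambda>x. span {x}) -` A \<inter> space sphere_measure = {x \<in> sphere 0 1. span {x} \<in> A}"
    by (auto simp: space_sphere_measure)
  ultimately show "(\<lambda>x. span {x}) -` A \<inter> space sphere_measure \<in> sets sphere_measure"
    by (simp add: sphere_measure_def)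
qed auto

lemma emeasure_RP_measure_space:
  "emeasure (RP_measure :: (real ^ 'n::finite) set measure) RP =
     ennreal (sphere_vol (CARD('n) - 1) / 2)"
proof -
  have "(\<lambda>x. span {x}) -` RP \<inter> space sphere_measure = sphere (0 :: real ^ 'n) 1"
    using span_singleton_in_RP by (auto simp: space_sphere_measure)
  moreover have "(RP :: (real ^ 'n) set set) \<in> sets RP_algebra"
    using sets.top[of "RP_algebra :: (real ^ 'n) set measure"] by (simp add: space_RP_algebra)
  ultimately have "emeasure (distr sphere_measure RP_algebra (\<lambda>x. span {x})) (RP :: (real ^ 'n) set set) =
      ennreal (sphere_vol (CARD('n) - 1))"
    using emeasure_sphere_measure_space[where 'a = "real ^ 'n"]
    by (simp add: emeasure_distr measurable_span_RP)
  then have "emeasure (RP_measure :: (real ^ 'n) set measure) RP =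
      (1 / 2) * ennreal (sphere_vol (CARD('n) - 1))"
    by (simp add: RP_measure_def)
  also have "(1 / 2 :: ennreal) = ennreal (1 / 2)"
    by (metis divide_ennreal ennreal_1 ennreal_numeral zero_le_one zero_less_numeral)
  also have "ennreal (1 / 2) * ennreal (sphere_vol (CARD('n) - 1)) =
      ennreal (sphere_vol (CARD('n) - 1) / 2)"
    by (subst ennreal_mult'[symmetric]) simp_all
  finally show ?thesis .
qed


section \<open>Total curvatures\<close>

definition real_hypersurface :: "('n::finite, real) mpoly \<Rightarrow> (real ^ 'n) set" where
  "real_hypersurface G = {x \<in> alg_torus. mp_eval G x = 0}"

text \<open>The point \<open>[v]\<close> of projective space is the line \<^term>\<open>span {v}\<close>.\<close>

definition log_gauss_map :: "('n::finite, real) mpoly \<Rightarrow> real ^ 'n \<Rightarrow> (real ^ 'n) set" where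
  "log_gauss_map G x = span {\<chi> i. x $ i * mp_eval (mp_partial i G) x}"

text \<open>Total curvature of the real amoeba; infinite fibres count as \<open>\<infinity>\<close>.\<close>

definition real_amoeba_total_curvature :: "('n::finite, real) mpoly \<Rightarrow> ennreal" where
  "real_amoeba_total_curvature G =
     (\<integral>\<^sup>+ \<beta>. emeasure (count_space UNIV) {x \<in> real_hypersurface G. log_gauss_map G x = \<beta>} \<partial>RP_measure)"

definition real_trop_total_curvature :: "('n::finite, real gpuiseux) mpoly \<Rightarrow> ennreal" where
  "real_trop_total_curvature F =
     Limsup (at_right 0) (\<lambda>t. real_amoeba_total_curvature (mp_at F t))"

text \<open>
  In the next two definitions the ambient space is \<open>R\<^bsup>n+1\<^esup>\<close>, so that \<open>CARD('n) = n + 1\<close>.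
\<close>

definition trop_total_curvature :: "('n::finite) trop_poly \<Rightarrow> real" where
  "trop_total_curvature f =
     (let n = CARD('n) - 1
      in (-1) ^ n * curv_const n * fact (n + 1) * measure lborel (trop_newton_polytope f) * CP_vol n)"

definition trop_total_abs_curvature :: "('n::finite) trop_poly \<Rightarrow> real" where
  "trop_total_abs_curvature f = (-1) ^ (CARD('n) - 1) * trop_total_curvature f"

end

theory Submission
  imports Defs
begin

text \<open>
  Write \<open>N = n + 1\<close> and \<open>\<theta>\<^sub>i = x\<^sub>i \<partial>G/\<partial>x\<^sub>i\<close> for a real polynomial \<open>G\<close> in \<open>N\<close> variables.  After cancelling
  the sphere volumes, the right-hand side of the theorem is \<open>\<sigma>\<^bsub>2n\<^esub>/2\<close> times \<open>N!\<close> times the volume of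
  the Newton polytope, and real projective space has volume \<open>\<sigma>\<^sub>n/2\<close>.  So it suffices that almost
  every fibre of the real logarithmic Gauss map of \<open>G = F\<^sub>t\<close> has at most \<open>N! vol(\<triangle>)\<close> points, where
  \<open>\<triangle>\<close> is the Newton polytope of \<open>G\<close>; the Newton polytope of \<open>F\<^sub>t\<close> lies in that of \<open>f\<close>.

  The fibre over \<open>[v]\<close>, with \<open>v\<^sub>j \<noteq> 0\<close>, is contained in the common zero set of the \<open>N\<close> polynomials \<open>G\<close>
  and \<open>v\<^sub>j \<theta>\<^sub>i - v\<^sub>i \<theta>\<^sub>j\<close> (\<open>i \<noteq> j\<close>), which are all supported in \<open>\<triangle>\<close>.  Two facts then give the bound
  (\<open>regular_fibre_card_le\<close>).

  \<^item> Sard: for almost every \<open>[v]\<close> the points of the fibre are nondegenerate zeros of this system, as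
    \<open>[v]\<close> is then a regular value of the Gauss map (\<open>negligible_critical_cone\<close>, \<open>critical_values_null\<close>).

  \<^item> Kushnirenko: \<open>N\<close> polynomials supported in a compact convex set \<open>D\<close> have at most \<open>N! vol(D)\<close>
    nondegenerate common zeros in the torus (\<open>nondegenerate_zeros_le_normalized_volume\<close>).

  The second fact has an elementary proof by counting dimensions, over the reals.  Let \<open>X\<close> be a
  finite set of nondegenerate zeros of \<open>g\<^sub>1, \<dots>, g\<^sub>N\<close>, let \<open>h\<^sub>x\<close> be a polynomial that vanishes on
  \<open>X - {x}\<close> but not at \<open>x\<close>, and let \<open>\<mu>\<close> be a monomial with exponent in \<open>D\<close>.  The products
  \<open>h\<^sub>x g\<^sup>a \<mu>\<^bsup>k-|a|\<^esup>\<close> for \<open>x \<in> X\<close> and \<open>|a| \<le> k\<close> are linearly independent: near \<open>x\<close> the \<open>g\<^sub>i\<close> are local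
  coordinates, and the terms of lowest order in a linear relation would form a polynomial relation
  between coordinates (\<open>local_products_independent\<close>).  All of them have their exponents within a
  bounded distance of \<open>k D\<close>, and there are at most \<open>k\<^sup>N (vol(D) + o(1))\<close> such exponents, whereas the
  number of products is at least \<open>|X| k\<^sup>N / N!\<close>.  Dividing by \<open>k\<^sup>N\<close> and letting \<open>k\<close> tend to infinity
  gives \<open>|X| \<le> N! vol(D)\<close>.
\<close>


section \<open>Polynomial functions and their supports\<close>

text \<open>
  Gaussian elimination: if some coefficient \<open>M a p\<close> of the equation \<open>a\<close> is nonzero, that equation
  determines \<open>c p\<close> from the other unknowns and can be substituted into the remaining equations.
\<close>

lemma underdetermined_system:
  fixes M :: "'a \<Rightarrow> 'b \<Rightarrow> 'c::field"
  assumes "finite A" "finite B" "card A < card B"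
  shows "\<exists>c. (\<exists>b\<in>B. c b \<noteq> 0) \<and> (\<forall>a\<in>A. (\<Sum>b\<in>B. M a b * c b) = 0)"
  using assms
proof (induction A arbitrary: B M rule: finite_induct)
  case empty
  then obtain b where "b \<in> B" by (metis card.empty less_irrefl all_not_in_conv)
  then show ?case by (intro exI[of _ "\<lambda>_. 1"]) auto
next
  case (insert a A)
  show ?case
  proof (cases "\<forall>b\<in>B. M a b = 0")
    case True
    have "card A < card B" using insert by simp
    from insert.IH[OF insert.prems(1) this, of M] obtain c where
      "\<exists>b\<in>B. c b \<noteq> 0" "\<forall>a\<in>A. (\<Sum>b\<in>B. M a b * c b) = 0" by blast
    then show ?thesis using True by (intro exI[of _ c]) auto
  next
    case False
    then obtain p where p: "p \<in> B" "M a p \<noteq> 0" by blast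
    define B' where "B' = B - {p}"
    have B': "finite B'" "p \<notin> B'" "B = insert p B'" using insert.prems p by (auto simp: B'_def)
    have "card A < card B'" using insert B' by simp
    from insert.IH[OF B'(1) this, of "\<lambda>r b. M r b - M r p * M a b / M a p"] obtain c where
      c: "\<exists>b\<in>B'. c b \<noteq> 0" "\<forall>r\<in>A. (\<Sum>b\<in>B'. (M r b - M r p * M a b / M a p) * c b) = 0" by blast
    define s where "s = (\<Sum>b\<in>B'. M a b * c b)"
    define c' where "c' = c(p := - s / M a p)"
    have sum: "(\<Sum>b\<in>B. M r b * c' b) = (\<Sum>b\<in>B'. M r b * c b) - M r p * s / M a p" for r
    proof -
      have "(\<Sum>b\<in>B. M r b * c' b) = M r p * c' p + (\<Sum>b\<in>B'. M r b * c' b)"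
        using B' by simp
      also have "(\<Sum>b\<in>B'. M r b * c' b) = (\<Sum>b\<in>B'. M r b * c b)"
        using B' by (intro sum.cong) (auto simp: c'_def)
      finally show ?thesis by (simp add: c'_def)
    qed
    have "(\<Sum>b\<in>B. M r b * c' b) = 0" if "r \<in> insert a A" for r
    proof (cases "r = a")
      case True
      then show ?thesis using p unfolding sum by (simp add: s_def)
    next
      case False
      then have "(\<Sum>b\<in>B'. (M r b - M r p * M a b / M a p) * c b) = 0" using c that by blast
      moreover have "(\<Sum>b\<in>B'. (M r b - M r p * M a b / M a p) * c b)
          = (\<Sum>b\<in>B'. M r b * c b) - M r p * s / M a p"
        by (simp add: s_def algebra_simps sum_subtractf sum_distrib_left sum_divide_distrib)
      ultimately show ?thesis unfolding sum by simp
    qed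
    moreover have "\<exists>b\<in>B. c' b \<noteq> 0" using c(1) B' by (metis c'_def fun_upd_apply insertCI)
    ultimately show ?thesis by blast
  qed
qed

definition monom_fn :: "nat ^ 'n \<Rightarrow> real ^ 'n::finite \<Rightarrow> real" where
  "monom_fn a x = (\<Prod>i\<in>UNIV. (x $ i) ^ (a $ i))"

lemma monom_fn_0: "monom_fn 0 x = 1"
  by (simp add: monom_fn_def)

lemma monom_fn_add: "monom_fn (a + b) x = monom_fn a x * monom_fn b x"
  by (simp add: monom_fn_def power_add prod.distrib)

lemma monom_fn_axis: "monom_fn (axis i 1) x = x $ i"
proof -
  have "monom_fn (axis i 1) x = (\<Prod>j\<in>UNIV. if j = i then x $ i else 1)"
    unfolding monom_fn_def by (rule prod.cong) (auto simp: axis_def)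
  then show ?thesis by simp
qed

lemma monom_fn_nonzero: "x \<in> alg_torus \<Longrightarrow> monom_fn a x \<noteq> 0"
  by (simp add: monom_fn_def alg_torus_def)

text \<open>
  The variables are treated one after the other.  With all the other variables held fixed, a
  vanishing polynomial in one variable has vanishing coefficients; so the relation remains valid if
  only the monomials with a prescribed exponent of that variable are kept.
\<close>

lemma polynomial_function_coeffs_zero:
  fixes c :: "nat ^ 'n::finite \<Rightarrow> real"
  assumes "finite A" and "\<And>w. (\<Sum>a\<in>A. c a * monom_fn a w) = 0" and "b \<in> A"
  shows "c b = 0"
proof -
  have "(\<Sum>a \<in> {a\<in>A. \<forall>i\<in>I. a $ i = b $ i}. c a) = 0"
    if "finite A" "\<And>w::real^'n. (\<Sum>a\<in>A. c a * (\<Prod>i\<in>I. (w $ i) ^ (a $ i))) = 0" "finite I" for I A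
    using that(3,1,2)
  proof (induction I arbitrary: A rule: finite_induct)
    case empty
    then show ?case by simp
  next
    case (insert j I)
    define A' where "A' = {a\<in>A. a $ j = b $ j}"
    have "(\<Sum>a\<in>A'. c a * (\<Prod>i\<in>I. (w $ i) ^ (a $ i))) = 0" for w :: "real^'n"
    proof -
      let ?m = "\<lambda>a. c a * (\<Prod>i\<in>I. (w $ i) ^ (a $ i))"
      define d where "d k = (\<Sum>a\<in>{a\<in>A. a $ j = k}. ?m a)" for k
      define N where "N = Max (insert (b $ j) ((\<lambda>a. a $ j) ` A))"
      have N: "a $ j \<le> N" if "a \<in> A" for a using insert.prems(1) that by (auto simp: N_def)
      have "(\<Sum>k\<le>N. d k * z ^ k) = 0" for z :: real
      proof -
        let ?w = "\<chi> i. if i = j then z else w $ i"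
        have "(\<Sum>k\<le>N. d k * z ^ k) = (\<Sum>k\<le>N. \<Sum>a\<in>{a\<in>A. a $ j = k}. ?m a * z ^ (a $ j))"
          by (simp add: d_def sum_distrib_right)
        also have "\<dots> = (\<Sum>a\<in>A. ?m a * z ^ (a $ j))"
          using N insert.prems(1) by (intro sum.group) auto
        also have "\<dots> = (\<Sum>a\<in>A. c a * (\<Prod>i\<in>insert j I. (?w $ i) ^ (a $ i)))"
        proof (rule sum.cong[OF refl])
          fix a
          have "(\<Prod>i\<in>I. (?w $ i) ^ (a $ i)) = (\<Prod>i\<in>I. (w $ i) ^ (a $ i))"
            using insert.hyps by (intro prod.cong) auto
          then show "?m a * z ^ (a $ j) = c a * (\<Prod>i\<in>insert j I. (?w $ i) ^ (a $ i))"
            using insert.hyps by simp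
        qed
        also have "\<dots> = 0" by (rule insert.prems(2))
        finally show ?thesis .
      qed
      then have "d (b $ j) = 0" using polyfun_eq_0[of d N] insert.prems(1) by (auto simp: N_def)
      then show ?thesis by (simp add: d_def A'_def)
    qed
    moreover have "finite A'" using insert.prems(1) by (simp add: A'_def)
    ultimately have "(\<Sum>a \<in> {a\<in>A'. \<forall>i\<in>I. a $ i = b $ i}. c a) = 0" by (rule insert.IH[rotated])
    moreover have "{a\<in>A'. \<forall>i\<in>I. a $ i = b $ i} = {a\<in>A. \<forall>i\<in>insert j I. a $ i = b $ i}"
      by (auto simp: A'_def)
    ultimately show ?case by simp
  qed
  from this[OF assms(1), of UNIV] assms(2)
  have "(\<Sum>a \<in> {a\<in>A. \<forall>i. a $ i = b $ i}. c a) = 0" by (simp add: monom_fn_def)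
  moreover have "{a\<in>A. \<forall>i. a $ i = b $ i} = {b}" using assms(3) by (auto simp: vec_eq_iff)
  ultimately show ?thesis by simp
qed

text \<open>
  Supports are constrained to a region of real space, not to a set of exponents, because
  multiplication then corresponds to Minkowski sums, and powers to dilates of convex sets.
\<close>

definition polys_in :: "(real ^ 'n::finite) set \<Rightarrow> (real ^ 'n \<Rightarrow> real) set" where
  "polys_in R = {p. \<exists>S c. finite S \<and> exponent_point ` S \<subseteq> R \<and> p = (\<lambda>x. \<Sum>a\<in>S. c a * monom_fn a x)}"

lemma exponent_point_add: "exponent_point (a + b) = exponent_point a + exponent_point b"
  by (simp add: exponent_point_def vec_eq_iff)

lemma exponent_point_0: "exponent_point 0 = 0"
  by (simp add: exponent_point_def vec_eq_iff)

lemma exponent_point_axis: "exponent_point (axis i 1) = axis i 1"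
  by (simp add: exponent_point_def vec_eq_iff axis_def)

lemma polys_in_mono: "p \<in> polys_in R \<Longrightarrow> R \<subseteq> R' \<Longrightarrow> p \<in> polys_in R'"
  unfolding polys_in_def by blast

lemma polys_in_sum_superset:
  assumes "p \<in> polys_in R" "finite T" "\<And>a. exponent_point a \<in> R \<Longrightarrow> a \<in> T"
  shows "\<exists>c. p = (\<lambda>x. \<Sum>a\<in>T. c a * monom_fn a x)"
proof -
  obtain S c where S: "finite S" "exponent_point ` S \<subseteq> R" "p = (\<lambda>x. \<Sum>a\<in>S. c a * monom_fn a x)"
    using assms(1) by (auto simp: polys_in_def)
  have "S \<subseteq> T" using S(2) assms(3) by blast
  then have "(\<Sum>a\<in>S. c a * monom_fn a x) = (\<Sum>a\<in>T. (if a \<in> S then c a else 0) * monom_fn a x)" for x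
    using assms(2) by (intro sum.mono_neutral_cong_left) auto
  then show ?thesis using S(3) by (intro exI[of _ "\<lambda>a. if a \<in> S then c a else 0"]) simp
qed

lemma polys_in_monom: "exponent_point a \<in> R \<Longrightarrow> (\<lambda>x. k * monom_fn a x) \<in> polys_in R"
  unfolding polys_in_def by (intro CollectI exI[of _ "{a}"] exI[of _ "\<lambda>_. k"]) auto

lemma polys_in_const: "0 \<in> R \<Longrightarrow> (\<lambda>x. k) \<in> polys_in R"
  using polys_in_monom[of 0 R k] by (simp add: exponent_point_0 monom_fn_0)

lemma polys_in_add:
  assumes "p \<in> polys_in R" "q \<in> polys_in R"
  shows "(\<lambda>x. p x + q x) \<in> polys_in R"
proof -
  obtain S c where S: "finite S" "exponent_point ` S \<subseteq> R" "p = (\<lambda>x. \<Sum>a\<in>S. c a * monom_fn a x)"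
    using assms(1) by (auto simp: polys_in_def)
  obtain T d where T: "finite T" "exponent_point ` T \<subseteq> R" "q = (\<lambda>x. \<Sum>a\<in>T. d a * monom_fn a x)"
    using assms(2) by (auto simp: polys_in_def)
  have "(\<Sum>a\<in>S. c a * monom_fn a x) = (\<Sum>a\<in>S \<union> T. (if a \<in> S then c a else 0) * monom_fn a x)" for x
    using S T by (intro sum.mono_neutral_cong_left) auto
  moreover have "(\<Sum>a\<in>T. d a * monom_fn a x) = (\<Sum>a\<in>S \<union> T. (if a \<in> T then d a else 0) * monom_fn a x)" for x
    using S T by (intro sum.mono_neutral_cong_left) auto
  ultimately have "p x + q x = (\<Sum>a\<in>S \<union> T. ((if a \<in> S then c a else 0) + (if a \<in> T then d a else 0)) * monom_fn a x)" for x
    using S T by (simp add: sum.distrib distrib_right)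
  moreover have "finite (S \<union> T)" "exponent_point ` (S \<union> T) \<subseteq> R" using S T by auto
  ultimately show ?thesis unfolding polys_in_def
    by (intro CollectI exI[of _ "S \<union> T"] exI[of _ "\<lambda>a. (if a \<in> S then c a else 0) + (if a \<in> T then d a else 0)"])
       auto
qed

lemma polys_in_mult:
  assumes "p \<in> polys_in R1" "q \<in> polys_in R2" "\<And>a b. a \<in> R1 \<Longrightarrow> b \<in> R2 \<Longrightarrow> a + b \<in> R"
  shows "(\<lambda>x. p x * q x) \<in> polys_in R"
proof -
  obtain S c where S: "finite S" "exponent_point ` S \<subseteq> R1" "p = (\<lambda>x. \<Sum>a\<in>S. c a * monom_fn a x)"
    using assms(1) by (auto simp: polys_in_def)
  obtain T d where T: "finite T" "exponent_point ` T \<subseteq> R2" "q = (\<lambda>x. \<Sum>a\<in>T. d a * monom_fn a x)"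
    using assms(2) by (auto simp: polys_in_def)
  let ?U = "(\<lambda>(a, b). a + b) ` (S \<times> T)"
  have "p x * q x = (\<Sum>e\<in>?U. (\<Sum>(a, b)\<in>{z\<in>S \<times> T. (\<lambda>(a, b). a + b) z = e}. c a * d b) * monom_fn e x)" for x
  proof -
    have "p x * q x = (\<Sum>(a, b)\<in>S \<times> T. c a * d b * monom_fn (a + b) x)"
      by (simp add: S(3) T(3) sum_product sum.cartesian_product monom_fn_add mult_ac)
    also have "\<dots> = (\<Sum>e\<in>?U. \<Sum>z\<in>{z\<in>S \<times> T. (\<lambda>(a, b). a + b) z = e}. (\<lambda>(a, b). c a * d b * monom_fn (a + b) x) z)"
      using S(1) T(1) by (intro sum.image_gen) auto
    also have "\<dots> = (\<Sum>e\<in>?U. (\<Sum>(a, b)\<in>{z\<in>S \<times> T. (\<lambda>(a, b). a + b) z = e}. c a * d b) * monom_fn e x)"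
      by (rule sum.cong[OF refl], subst sum_distrib_right, rule sum.cong) auto
    finally show ?thesis .
  qed
  moreover have "finite ?U" using S T by simp
  moreover have "exponent_point ` ?U \<subseteq> R"
    using S(2) T(2) by (fastforce simp: exponent_point_add intro: assms(3))
  ultimately show ?thesis unfolding polys_in_def
    by (intro CollectI exI[of _ ?U] exI[of _ "\<lambda>e. \<Sum>(a, b)\<in>{z\<in>S \<times> T. (\<lambda>(a, b). a + b) z = e}. c a * d b"])
       auto
qed

text \<open>
  The polynomial is a product of factors \<open>z\<^sub>l - y\<^sub>l\<close>, one for each \<open>y\<close>, where \<open>l\<close> is a coordinate that
  distinguishes \<open>y\<close> from \<open>x\<close>; each factor enlarges the support by at most one unit.
\<close>

lemma polynomial_vanishing_on_finite_set:
  fixes x :: "real ^ 'n::finite"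
  assumes "finite Y" "x \<notin> Y"
  shows "\<exists>h \<rho>. h \<in> polys_in (cball 0 \<rho>) \<and> h x \<noteq> 0 \<and> (\<forall>y\<in>Y. h y = 0)"
  using assms
proof (induction Y rule: finite_induct)
  case empty
  have "(\<lambda>x. 1) \<in> polys_in (cball (0::real^'n) 0)" by (rule polys_in_const) simp
  then show ?case by fastforce
next
  case (insert y Y)
  then obtain h \<rho> where h: "h \<in> polys_in (cball 0 \<rho>)" "h x \<noteq> 0" "\<forall>y\<in>Y. h y = 0" by auto
  from insert.prems obtain l where l: "x $ l \<noteq> y $ l" by (auto simp: vec_eq_iff)
  have "(\<lambda>x. 1 * monom_fn (axis l 1) x) \<in> polys_in (cball (0::real^'n) 1)"
    by (rule polys_in_monom) (simp add: exponent_point_axis del: One_nat_def)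
  then have "(\<lambda>x. x $ l) \<in> polys_in (cball (0::real^'n) 1)" by (simp only: monom_fn_axis mult_1)
  from polys_in_add[OF this polys_in_const[of _ "- (y $ l)"]]
  have "(\<lambda>x. x $ l + - (y $ l)) \<in> polys_in (cball 0 1)" by simp
  then have "(\<lambda>x. h x * (x $ l + - (y $ l))) \<in> polys_in (cball 0 (\<rho> + 1))"
    by (rule polys_in_mult[OF h(1)]) (auto intro: norm_triangle_le)
  then show ?case using h l by (intro exI[of _ "\<lambda>x. h x * (x $ l + - (y $ l))"]) auto
qed


section \<open>Integer points and volume\<close>

definition thickening :: "'a::euclidean_space set \<Rightarrow> real \<Rightarrow> 'a set" where
  "thickening D r = {x. infdist x D \<le> r}"

lemma thickening_compact:
  fixes D :: "'a::euclidean_space set"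
  assumes "compact D" "D \<noteq> {}"
  shows "compact (thickening D r)"
  unfolding compact_eq_bounded_closed
proof
  obtain B where B: "\<And>x. x \<in> D \<Longrightarrow> norm x \<le> B"
    using compact_imp_bounded[OF assms(1)] by (auto simp: bounded_iff)
  have "norm x \<le> B + r" if "x \<in> thickening D r" for x
  proof -
    obtain d where "d \<in> D" "infdist x D = dist x d"
      using infdist_attains_inf[OF compact_imp_closed[OF assms(1)] assms(2)] by blast
    then show ?thesis using that B[of d] norm_triangle_sub[of x d]
      by (simp add: thickening_def dist_norm)
  qed
  then show "bounded (thickening D r)" by (auto simp: bounded_iff)
  show "closed (thickening D r)" unfolding thickening_def
    by (intro closed_Collect_le continuous_intros)
qed

text \<open>
  A compact set is the decreasing intersection of its closed thickenings, which have finite measure.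
\<close>

lemma measure_thickening_tendsto:
  fixes D :: "'a::euclidean_space set"
  assumes "compact D" "D \<noteq> {}" "0 \<le> r"
  shows "(\<lambda>k. measure lborel (thickening D (r / Suc k))) \<longlonglongrightarrow> measure lborel D"
proof -
  have "(\<lambda>k. measure lborel (thickening D (r / Suc k)))
      \<longlonglongrightarrow> measure lborel (\<Inter>k. thickening D (r / Suc k))"
  proof (rule Lim_measure_decseq)
    show "range (\<lambda>k. thickening D (r / real (Suc k))) \<subseteq> sets lborel"
      using thickening_compact[OF assms(1,2)] by (auto simp: borel_compact)
    show "decseq (\<lambda>k. thickening D (r / real (Suc k)))"
    proof (rule decseq_SucI)
      fix k
      have "r / real (Suc (Suc k)) \<le> r / real (Suc k)"
        using assms(3) by (intro divide_left_mono) auto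
      then show "thickening D (r / real (Suc (Suc k))) \<subseteq> thickening D (r / real (Suc k))"
        unfolding thickening_def by auto
    qed
    show "emeasure lborel (thickening D (r / real (Suc k))) \<noteq> \<infinity>" for k
      using emeasure_lborel_cbox_finite emeasure_compact_finite[OF thickening_compact[OF assms(1,2)]]
      by (metis infinity_ennreal_def less_irrefl)
  qed
  also have "(\<Inter>k. thickening D (r / Suc k)) = D"
  proof
    show "D \<subseteq> (\<Inter>k. thickening D (r / Suc k))" using assms(3) by (auto simp: thickening_def)
    have "infdist x D = 0" if "x \<in> (\<Inter>k. thickening D (r / Suc k))" for x
    proof -
      have "\<forall>k. infdist x D \<le> r / real (Suc k)" using that by (auto simp: thickening_def)
      moreover have "(\<lambda>k. r / real (Suc k)) \<longlonglongrightarrow> 0"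
        using lim_const_over_n[of r] by (rule LIMSEQ_Suc)
      ultimately have "infdist x D \<le> 0" by (intro LIMSEQ_le_const) auto
      then show ?thesis using infdist_nonneg[of x D] by simp
    qed
    then show "(\<Inter>k. thickening D (r / Suc k)) \<subseteq> D"
      using in_closed_iff_infdist_zero[OF compact_imp_closed[OF assms(1)] assms(2)] by blast
  qed
  finally show ?thesis .
qed

lemma measure_scaleR_image:
  fixes S :: "'a::euclidean_space set"
  assumes "compact S" "0 \<le> c"
  shows "measure lborel ((*\<^sub>R) c ` S) = c ^ DIM('a) * measure lborel S"
proof -
  have "measure lebesgue ((\<lambda>x. c *\<^sub>R x + 0) ` S) = \<bar>c\<bar> ^ DIM('a) * measure lebesgue S"
    by (rule measure_lebesgue_affine)
  moreover have "S \<in> sets lborel" "(*\<^sub>R) c ` S \<in> sets lborel"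
    using assms(1) compact_scaling[OF assms(1), of c] by (auto simp: borel_compact)
  ultimately show ?thesis using assms(2) by (simp add: measure_completion)
qed

lemma measure_unit_cube: "measure lborel (box a (a + One)) = (1::real)"
  "measure lborel (cbox a (a + One)) = (1::real)" for a :: "'a::euclidean_space"
  by (simp_all add: measure_lborel_box_eq measure_lborel_cbox_eq inner_add_left)

lemma sum_Basis_nth [simp]: "(\<Sum>b\<in>Basis. (b :: real ^ 'n::finite) $ i) = 1"
proof -
  have "(One :: real ^ 'n) $ i = 1" by (simp add: cart_eq_inner_axis)
  then show ?thesis by simp
qed

lemma exponent_cubes_disjoint:
  assumes "a \<noteq> b"
  shows "box (exponent_point a) (exponent_point a + One) \<inter>
    box (exponent_point b) (exponent_point b + One) = {}"
proof -
  obtain i where i: "a $ i \<noteq> b $ i" using assms by (auto simp: vec_eq_iff)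
  have "False" if x: "x \<in> box (exponent_point a) (exponent_point a + One)"
    "x \<in> box (exponent_point b) (exponent_point b + One)" for x
  proof -
    have "real (a $ i) < x $ i" "x $ i < real (a $ i) + 1" "real (b $ i) < x $ i" "x $ i < real (b $ i) + 1"
      using x by (auto simp: mem_box_cart exponent_point_def)
    then show False using i by linarith
  qed
  then show ?thesis by blast
qed

text \<open>
  The open unit cubes whose lowest corners are integer points are pairwise disjoint.
\<close>

lemma card_exponents_le_measure:
  fixes D :: "(real ^ 'n::finite) set"
  assumes "finite T" "compact D" "\<And>a. a \<in> T \<Longrightarrow> cbox (exponent_point a) (exponent_point a + One) \<subseteq> D"
  shows "real (card T) \<le> measure lborel D"
proof -
  let ?c = "\<lambda>a::nat^'n. box (exponent_point a) (exponent_point a + One)"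
  have "real (card T) = (\<Sum>a\<in>T. measure lborel (?c a))" by (simp add: measure_unit_cube)
  also have "\<dots> = measure lborel (\<Union>a\<in>T. ?c a)"
    using assms(1) exponent_cubes_disjoint
    by (intro measure_finite_Union[symmetric])
       (auto simp: disjoint_family_on_def emeasure_lborel_box_eq)
  also have "\<dots> \<le> measure lborel D"
  proof (rule measure_mono_fmeasurable)
    show "(\<Union>a\<in>T. ?c a) \<subseteq> D" using assms(3) box_subset_cbox by blast
    show "D \<in> fmeasurable lborel" using assms(2) by (rule fmeasurable_compact)
  qed auto
  finally show ?thesis .
qed

lemma finite_bounded_exponents: "finite {a :: nat ^ 'n::finite. \<forall>i. a $ i \<le> m}"
proof -
  have "{a :: nat ^ 'n. \<forall>i. a $ i \<le> m} \<subseteq> vec_lambda ` (UNIV \<rightarrow>\<^sub>E {..m})"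
  proof
    fix a :: "nat ^ 'n" assume "a \<in> {a. \<forall>i. a $ i \<le> m}"
    then have "($) a \<in> UNIV \<rightarrow>\<^sub>E {..m}" by auto
    then show "a \<in> vec_lambda ` (UNIV \<rightarrow>\<^sub>E {..m})" by (metis image_eqI vec_nth_inverse)
  qed
  then show ?thesis by (rule finite_subset) (intro finite_imageI finite_PiE; simp)
qed

text \<open>
  The closed unit cubes at the exponents of degree at most \<open>k\<close> cover the standard simplex dilated by
  \<open>k\<close>, since rounding down the coordinates of a point does not increase their sum.
\<close>

lemma card_exponents_degree_le:
  "real k ^ CARD('n) / fact CARD('n) \<le> real (card {a :: nat ^ 'n::finite. (\<Sum>i\<in>UNIV. a $ i) \<le> k})"
proof -
  let ?A = "{a :: nat ^ 'n. (\<Sum>i\<in>UNIV. a $ i) \<le> k}"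
  let ?S = "convex hull (insert 0 Basis :: (real ^ 'n) set)"
  let ?c = "\<lambda>a::nat^'n. cbox (exponent_point a) (exponent_point a + One)"
  have fin: "finite ?A"
  proof (rule finite_subset[OF _ finite_bounded_exponents[of k]])
    have "a $ i \<le> (\<Sum>i\<in>UNIV. a $ i)" for a :: "nat ^ 'n" and i by (rule member_le_sum) auto
    then show "?A \<subseteq> {a. \<forall>i. a $ i \<le> k}" by (auto intro: order_trans)
  qed
  have cpt: "compact ?S" by (intro finite_imp_compact_convex_hull) simp
  have "real k ^ CARD('n) / fact CARD('n) = measure lborel ((*\<^sub>R) (real k) ` ?S)"
    by (subst measure_scaleR_image[OF cpt]) (simp_all add: content_std_simplex)
  also have "\<dots> \<le> measure lborel (\<Union>a\<in>?A. ?c a)"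
  proof (rule measure_mono_fmeasurable)
    show "(*\<^sub>R) (real k) ` ?S \<subseteq> (\<Union>a\<in>?A. ?c a)"
    proof
      fix y assume "y \<in> (*\<^sub>R) (real k) ` ?S"
      then obtain x where x: "x \<in> ?S" "y = real k *\<^sub>R x" by blast
      have b: "\<And>i. 0 \<le> x $ i" "(\<Sum>i\<in>UNIV. x $ i) \<le> 1"
        using x(1) unfolding std_simplex
        by (auto simp: Basis_vec_def inner_axis sum.UNION_disjoint axis_eq_axis)
      define a :: "nat ^ 'n" where "a = (\<chi> i. nat \<lfloor>y $ i\<rfloor>)"
      have y0: "0 \<le> y $ i" for i using b x by simp
      have a: "real (a $ i) \<le> y $ i" "y $ i \<le> real (a $ i) + 1" for i
        using y0[of i] by (auto simp: a_def)
      have "real (\<Sum>i\<in>UNIV. a $ i) \<le> (\<Sum>i\<in>UNIV. y $ i)" using a(1) by (auto intro: sum_mono)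
      also have "\<dots> = real k * (\<Sum>i\<in>UNIV. x $ i)" by (simp add: x sum_distrib_left)
      also have "\<dots> \<le> real k * 1" using b(2) by (intro mult_left_mono) auto
      finally have "(\<Sum>i\<in>UNIV. a $ i) \<le> k" by linarith
      then have "a \<in> ?A" by simp
      moreover have "y \<in> ?c a" using a
        by (auto simp: mem_box_cart exponent_point_def)
      ultimately show "y \<in> (\<Union>a\<in>?A. ?c a)" by blast
    qed
    show "(*\<^sub>R) (real k) ` ?S \<in> sets lborel"
      using compact_scaling[OF cpt, of "real k"] by (simp add: borel_compact)
    show "(\<Union>a\<in>?A. ?c a) \<in> fmeasurable lborel"
      using fin by (intro fmeasurable_compact compact_UN) auto
  qed
  also have "\<dots> \<le> (\<Sum>a\<in>?A. measure lborel (?c a))"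
    by (rule measure_UNION_le[OF fin]) simp
  also have "\<dots> = real (card ?A)" by (simp add: measure_unit_cube)
  finally show ?thesis .
qed


section \<open>Counting nondegenerate zeros in the torus\<close>

text \<open>
  With \<open>s = j / (j + k)\<close> and \<open>t = k / (j + k)\<close>, the sum \<open>j a + k b\<close> is \<open>j + k\<close> times the convex
  combination \<open>s a + t b\<close>.
\<close>

lemma dilate_add_mem:
  fixes D :: "'a::real_vector set"
  assumes "convex D" "p \<in> (*\<^sub>R) (real j) ` D" "q \<in> (*\<^sub>R) (real k) ` D"
  shows "p + q \<in> (*\<^sub>R) (real (j + k)) ` D"
proof -
  obtain a b where ab: "a \<in> D" "b \<in> D" "p = real j *\<^sub>R a" "q = real k *\<^sub>R b"
    using assms by blast
  show ?thesis
  proof (cases "j + k = 0")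
    case True
    then show ?thesis using ab by auto
  next
    case False
    then have nz: "real j + real k \<noteq> 0" by (metis of_nat_add of_nat_eq_0_iff)
    define s where "s = real j / real (j + k)"
    define t where "t = real k / real (j + k)"
    have "s + t = 1" using nz by (simp add: s_def t_def add_divide_distrib[symmetric])
    moreover have "0 \<le> s" "0 \<le> t" by (simp_all add: s_def t_def)
    ultimately have "s *\<^sub>R a + t *\<^sub>R b \<in> D" using assms(1) ab by (intro convexD)
    moreover have "p + q = real (j + k) *\<^sub>R (s *\<^sub>R a + t *\<^sub>R b)"
      using nz by (simp add: ab s_def t_def scaleR_add_right)
    ultimately show ?thesis by blast
  qed
qed

lemma polys_in_power:
  assumes "convex D" "D \<noteq> {}" "p \<in> polys_in D"
  shows "(\<lambda>x. p x ^ k) \<in> polys_in ((*\<^sub>R) (real k) ` D)"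
proof (induction k)
  case 0
  then show ?case using assms(2) by (auto intro!: polys_in_const)
next
  case (Suc k)
  have "p \<in> polys_in ((*\<^sub>R) (real 1) ` D)" using assms(3) by simp
  from polys_in_mult[OF this Suc, of "(*\<^sub>R) (real (1 + k)) ` D"] show ?case
    using dilate_add_mem[OF assms(1), of _ 1 _ k] by simp
qed

lemma polys_in_prod_power:
  assumes "convex D" "D \<noteq> {}" "\<And>i. i \<in> I \<Longrightarrow> p i \<in> polys_in D" "finite I"
  shows "(\<lambda>x. \<Prod>i\<in>I. p i x ^ a i) \<in> polys_in ((*\<^sub>R) (real (\<Sum>i\<in>I. a i)) ` D)"
  using assms(4,3)
proof (induction I rule: finite_induct)
  case empty
  then show ?case using assms(2) by (auto intro!: polys_in_const)
next
  case (insert i I)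
  have "(\<lambda>x. p i x ^ a i) \<in> polys_in ((*\<^sub>R) (real (a i)) ` D)"
    using insert.prems by (intro polys_in_power assms(1,2)) simp
  moreover have "(\<lambda>x. \<Prod>i\<in>I. p i x ^ a i) \<in> polys_in ((*\<^sub>R) (real (\<Sum>i\<in>I. a i)) ` D)"
    using insert by simp
  ultimately have "(\<lambda>x. p i x ^ a i * (\<Prod>i\<in>I. p i x ^ a i))
      \<in> polys_in ((*\<^sub>R) (real (a i + (\<Sum>i\<in>I. a i))) ` D)"
    by (rule polys_in_mult) (rule dilate_add_mem[OF assms(1)])
  then show ?case using insert.hyps by simp
qed

lemma linearization_along_line:
  fixes p :: "'a::real_normed_vector \<Rightarrow> real"
  assumes "(p has_derivative p') (at x)" "p x = 0"
  shows "((\<lambda>\<epsilon>. p (x + \<epsilon> *\<^sub>R u) / \<epsilon>) \<longlongrightarrow> p' u) (at 0)"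
proof -
  have "((\<lambda>\<epsilon>. x + \<epsilon> *\<^sub>R u) has_derivative (\<lambda>\<epsilon>. \<epsilon> *\<^sub>R u)) (at 0)"
    by (auto intro!: derivative_eq_intros)
  moreover have "(p has_derivative p') (at (x + 0 *\<^sub>R u))" using assms(1) by simp
  ultimately have "((\<lambda>\<epsilon>. p (x + \<epsilon> *\<^sub>R u)) has_derivative (\<lambda>\<epsilon>. p' (\<epsilon> *\<^sub>R u))) (at 0)"
    by (rule has_derivative_compose)
  moreover have "p' (\<epsilon> *\<^sub>R u) = p' u * \<epsilon>" for \<epsilon>
    using has_derivative_linear[OF assms(1)] by (simp add: linear_cmul)
  ultimately have "((\<lambda>\<epsilon>. p (x + \<epsilon> *\<^sub>R u)) has_field_derivative p' u) (at 0)"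
    by (simp add: has_field_derivative_def)
  then show ?thesis using assms(2) by (simp add: DERIV_def)
qed

lemma continuous_polys_in:
  assumes "p \<in> polys_in R"
  shows "continuous_on UNIV p"
proof -
  obtain S c where "p = (\<lambda>x. \<Sum>a\<in>S. c a * monom_fn a x)" using assms by (auto simp: polys_in_def)
  then show ?thesis by (auto simp: monom_fn_def intro!: continuous_intros)
qed

text \<open>
  Among the terms with a nonzero coefficient choose one, \<open>(x\<^sub>0, a\<^sub>0)\<close>, whose degree \<open>d = |a\<^sub>0|\<close> is
  minimal, restrict the relation to a line through \<open>x\<^sub>0\<close> with direction \<open>u\<close>, and divide by \<open>\<epsilon>\<^sup>d\<close>.  As
  \<open>\<epsilon> \<rightarrow> 0\<close>, the terms of degree greater than \<open>d\<close> and those with \<open>x \<noteq> x\<^sub>0\<close> disappear, and each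
  \<open>g\<^sub>i(x\<^sub>0 + \<epsilon> u) / \<epsilon>\<close> tends to the derivative of \<open>g\<^sub>i\<close> in direction \<open>u\<close>.  Since \<open>x\<^sub>0\<close> is nondegenerate,
  the vector of these derivatives is arbitrary, so a nonzero polynomial would vanish everywhere.
\<close>

lemma local_products_independent:
  fixes g :: "'n::finite \<Rightarrow> real ^ 'n \<Rightarrow> real" and A :: "(nat ^ 'n) set"
  assumes fin: "finite X" "finite A"
    and zero: "\<And>i x. x \<in> X \<Longrightarrow> g i x = 0"
    and deriv: "\<And>i x. x \<in> X \<Longrightarrow> (g i has_derivative g' x i) (at x)"
    and nondeg: "\<And>x u. x \<in> X \<Longrightarrow> u \<noteq> 0 \<Longrightarrow> \<exists>i. g' x i u \<noteq> 0"
    and h: "\<And>x. continuous_on UNIV (h x)" "\<And>x. x \<in> X \<Longrightarrow> h x x \<noteq> 0"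
      "\<And>x y. x \<in> X \<Longrightarrow> y \<in> X \<Longrightarrow> x \<noteq> y \<Longrightarrow> h x y = 0"
    and m: "\<And>a. continuous_on UNIV (m a)" "\<And>a x. x \<in> X \<Longrightarrow> m a x \<noteq> 0"
    and relation: "\<And>z. (\<Sum>(x, a)\<in>X \<times> A. c (x, a) * (h x z * (\<Prod>i\<in>UNIV. g i z ^ (a $ i)) * m a z)) = 0"
    and xa: "(x, a) \<in> X \<times> A"
  shows "c (x, a) = 0"
proof (rule ccontr)
  assume "c (x, a) \<noteq> 0"
  define deg :: "nat ^ 'n \<Rightarrow> nat" where "deg a = (\<Sum>i\<in>UNIV. a $ i)" for a
  define d where "d = (LEAST d. \<exists>x\<in>X. \<exists>a\<in>A. c (x, a) \<noteq> 0 \<and> deg a = d)"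
  have ex: "\<exists>d. \<exists>x\<in>X. \<exists>a\<in>A. c (x, a) \<noteq> 0 \<and> deg a = d" using xa \<open>c (x, a) \<noteq> 0\<close> by auto
  obtain x0 a0 where x0: "x0 \<in> X" "a0 \<in> A" "c (x0, a0) \<noteq> 0" "deg a0 = d"
    using LeastI_ex[OF ex] unfolding d_def by blast
  have least: "d \<le> deg a" if "x \<in> X" "a \<in> A" "c (x, a) \<noteq> 0" for x a
    unfolding d_def using that by (intro Least_le) blast
  have deg_prod: "(\<Prod>i\<in>UNIV. t ^ (a $ i)) = t ^ deg a" for t :: real and a
    by (simp add: deg_def power_sum)
  define L :: "real ^ 'n \<Rightarrow> real ^ 'n" where "L u = (\<chi> i. g' x0 i u)" for u
  have "linear L"
  proof -
    have "linear (g' x0 i)" for i using deriv[OF x0(1)] by (rule has_derivative_linear)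
    then show ?thesis by (auto simp: linear_iff L_def vec_eq_iff)
  qed
  moreover have "inj L"
    unfolding linear_injective_0[OF \<open>linear L\<close>]
    using nondeg[OF x0(1)] by (auto simp: L_def vec_eq_iff)
  ultimately have "surj L" by (simp add: linear_injective_imp_surjective)
  \<comment> \<open>The factor \<open>0 ^ (deg a - d)\<close>, the limit of \<open>\<epsilon> ^ (deg a - d)\<close>, selects the terms of degree \<open>d\<close>.\<close>
  have lead: "(\<Sum>a\<in>A. (c (x0, a) * 0 ^ (deg a - d) * m a x0) * monom_fn a w) = 0" for w
  proof -
    obtain u where u: "w = L u" using \<open>surj L\<close> by (auto simp: surj_def)
    have assoc4: "e * (k * (u * v * w)) = k * (u * (e * v) * w)" for e k u v w :: real
      by (simp only: mult_ac)
    have cancel: "0 = b" if "e * b = 0" "e \<noteq> 0" for e b :: real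
      using that by simp
    let ?\<gamma> = "\<lambda>\<epsilon>::real. x0 + \<epsilon> *\<^sub>R u"
    let ?q = "\<lambda>\<epsilon> i. g i (?\<gamma> \<epsilon>) / \<epsilon>"
    let ?f = "\<lambda>\<epsilon>. \<Sum>(x, a)\<in>X \<times> A.
      c (x, a) * (h x (?\<gamma> \<epsilon>) * (\<epsilon> ^ (deg a - d) * (\<Prod>i\<in>UNIV. ?q \<epsilon> i ^ (a $ i))) * m a (?\<gamma> \<epsilon>))"
    have cont: "((\<lambda>\<epsilon>. p (?\<gamma> \<epsilon>)) \<longlongrightarrow> p x0) (at 0)" if "continuous_on UNIV p" for p :: "real ^ 'n \<Rightarrow> real"
    proof -
      have "continuous_on UNIV (\<lambda>\<epsilon>. p (?\<gamma> \<epsilon>))"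
        by (rule continuous_on_compose2[OF that]) (auto intro!: continuous_intros)
      then have "isCont (\<lambda>\<epsilon>. p (?\<gamma> \<epsilon>)) 0" by (simp add: continuous_on_eq_continuous_at)
      then show ?thesis by (simp add: isCont_def)
    qed
    have lim1: "(?f \<longlongrightarrow> (\<Sum>(x, a)\<in>X \<times> A.
        c (x, a) * (h x x0 * (0 ^ (deg a - d) * (\<Prod>i\<in>UNIV. (w $ i) ^ (a $ i))) * m a x0))) (at 0)"
      unfolding case_prod_beta
      by (intro tendsto_intros cont h m)
         (simp add: u L_def linearization_along_line deriv zero x0)
    have lim2: "(?f \<longlongrightarrow> 0) (at 0)"
    proof (rule Lim_transform_eventually[OF tendsto_const])
      have *: "0 = ?f \<epsilon>" if "\<epsilon> \<noteq> 0" for \<epsilon>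
      proof -
        have "\<epsilon> ^ d * ?f \<epsilon> = (\<Sum>(x, a)\<in>X \<times> A.
            c (x, a) * (h x (?\<gamma> \<epsilon>) * (\<Prod>i\<in>UNIV. g i (?\<gamma> \<epsilon>) ^ (a $ i)) * m a (?\<gamma> \<epsilon>)))"
          unfolding sum_distrib_left
        proof (intro sum.cong refl, clarify)
          fix x a assume "x \<in> X" "a \<in> A"
          show "\<epsilon> ^ d * (c (x, a) * (h x (?\<gamma> \<epsilon>) * (\<epsilon> ^ (deg a - d) * (\<Prod>i\<in>UNIV. ?q \<epsilon> i ^ (a $ i))) * m a (?\<gamma> \<epsilon>)))
              = c (x, a) * (h x (?\<gamma> \<epsilon>) * (\<Prod>i\<in>UNIV. g i (?\<gamma> \<epsilon>) ^ (a $ i)) * m a (?\<gamma> \<epsilon>))"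
          proof (cases "c (x, a) = 0")
            case False
            then have "\<epsilon> ^ d * \<epsilon> ^ (deg a - d) = \<epsilon> ^ deg a"
              using least[OF \<open>x \<in> X\<close> \<open>a \<in> A\<close>] by (simp flip: power_add)
            moreover have "\<epsilon> ^ deg a * (\<Prod>i\<in>UNIV. ?q \<epsilon> i ^ (a $ i)) = (\<Prod>i\<in>UNIV. g i (?\<gamma> \<epsilon>) ^ (a $ i))"
              unfolding deg_prod[symmetric] prod.distrib[symmetric]
              using that by (simp flip: power_mult_distrib)
            ultimately have "\<epsilon> ^ d * (\<epsilon> ^ (deg a - d) * (\<Prod>i\<in>UNIV. ?q \<epsilon> i ^ (a $ i)))
                = (\<Prod>i\<in>UNIV. g i (?\<gamma> \<epsilon>) ^ (a $ i))"
              by (simp only: mult.assoc[symmetric])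
            then show ?thesis by (subst assoc4) (rule arg_cong)
          qed simp
        qed
        also have "\<dots> = 0" by (rule relation)
        finally have "\<epsilon> ^ d * ?f \<epsilon> = 0" .
        then show ?thesis by (rule cancel) (rule power_not_zero[OF that])
      qed
      show "\<forall>\<^sub>F \<epsilon> in at 0. 0 = ?f \<epsilon>"
        unfolding eventually_at_filter by (intro always_eventually allI impI *)
    qed
    have "(\<Sum>(x, a)\<in>X \<times> A.
        c (x, a) * (h x x0 * (0 ^ (deg a - d) * monom_fn a w) * m a x0)) = 0"
      unfolding monom_fn_def by (rule tendsto_unique[OF at_neq_bot lim1 lim2])
    moreover have "(\<Sum>(x, a)\<in>X \<times> A.
        c (x, a) * (h x x0 * (0 ^ (deg a - d) * monom_fn a w) * m a x0))
      = (\<Sum>x\<in>X. \<Sum>a\<in>A. c (x, a) * (h x x0 * (0 ^ (deg a - d) * monom_fn a w) * m a x0))"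
      by (simp add: sum.cartesian_product)
    moreover have "\<dots> = (\<Sum>x\<in>{x0}. \<Sum>a\<in>A. c (x, a) * (h x x0 * (0 ^ (deg a - d) * monom_fn a w) * m a x0))"
      using fin x0(1) h(3) by (intro sum.mono_neutral_right) auto
    moreover have "\<dots> = h x0 x0 * (\<Sum>a\<in>A. (c (x0, a) * 0 ^ (deg a - d) * m a x0) * monom_fn a w)"
      by (simp add: sum_distrib_left mult_ac)
    ultimately show ?thesis using h(2)[OF x0(1)] by simp
  qed
  have "c (x0, a0) * 0 ^ (deg a0 - d) * m a0 x0 = 0"
    by (rule polynomial_function_coeffs_zero[OF fin(2) lead x0(2)])
  then show False using x0 m(2)[OF x0(1)] by simp
qed

text \<open>
  The real form of Kushnirenko's theorem.  The exponents that occur in the products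
  \<open>h\<^sub>x g\<^sup>a \<mu>\<^bsup>k-|a|\<^esup>\<close> lie within \<open>\<rho>\<close> of \<open>k D\<close>, where \<open>\<rho>\<close> bounds the supports of the \<open>h\<^sub>x\<close> and is
  independent of \<open>k\<close>.  The unit cubes at these exponents lie within \<open>r = \<rho> + \<close> (diameter of a unit
  cube) of \<open>k D\<close>, that is, in the dilate by \<open>k\<close> of the thickening of \<open>D\<close> by \<open>r / k\<close>.
\<close>

theorem nondegenerate_zeros_le_normalized_volume:
  fixes g :: "'n::finite \<Rightarrow> real ^ 'n \<Rightarrow> real"
  assumes D: "compact D" "convex D" "exponent_point \<alpha> \<in> D"
    and supp: "\<And>i. g i \<in> polys_in D"
    and X: "finite X" "X \<subseteq> alg_torus"
    and zero: "\<And>i x. x \<in> X \<Longrightarrow> g i x = 0"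
    and deriv: "\<And>i x. x \<in> X \<Longrightarrow> (g i has_derivative g' x i) (at x)"
    and nondeg: "\<And>x u. x \<in> X \<Longrightarrow> u \<noteq> 0 \<Longrightarrow> \<exists>i. g' x i u \<noteq> 0"
  shows "real (card X) \<le> fact CARD('n) * measure lborel D"
proof -
  have "\<forall>x. \<exists>h \<rho>. h \<in> polys_in (cball 0 \<rho>) \<and> h x \<noteq> 0 \<and> (\<forall>y\<in>X - {x}. h y = 0)"
    using polynomial_vanishing_on_finite_set[of "X - {x}" x for x] X(1) by blast
  then obtain h \<rho>' where h: "\<And>x. h x \<in> polys_in (cball 0 (\<rho>' x))" "\<And>x. h x x \<noteq> 0"
    "\<And>x y. y \<in> X \<Longrightarrow> x \<noteq> y \<Longrightarrow> h x y = 0" by (metis DiffI singletonD)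
  define \<rho> where "\<rho> = Max (insert 0 (\<rho>' ` X))"
  have \<rho>: "\<rho>' x \<le> \<rho>" if "x \<in> X" for x using X(1) that by (simp add: \<rho>_def)
  have "0 \<le> \<rho>" using X(1) by (simp add: \<rho>_def)
  define r where "r = \<rho> + norm (One :: real ^ 'n)"
  have "0 \<le> r" using \<open>0 \<le> \<rho>\<close> by (simp add: r_def)
  have "D \<noteq> {}" using D(3) by blast
  have bound: "real (card X) / fact CARD('n) \<le> measure lborel (thickening D (r / Suc l))" for l
  proof -
    define k where "k = Suc l"
    have "0 < real k" by (simp add: k_def)
    define A where "A = {a :: nat ^ 'n. (\<Sum>i\<in>UNIV. a $ i) \<le> k}"
    define E where "E = (*\<^sub>R) (real k) ` thickening D (r / k)"
    have "compact E" unfolding E_def by (intro compact_scaling thickening_compact D \<open>D \<noteq> {}\<close>)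
    define T where "T = {a :: nat ^ 'n. cbox (exponent_point a) (exponent_point a + One) \<subseteq> E}"
    have mem_T: "a \<in> T" if pq: "exponent_point a = p + q" "norm p \<le> \<rho>" "q \<in> (*\<^sub>R) (real k) ` D" for a p q
      unfolding T_def
    proof (intro CollectI subsetI)
      fix z assume z: "z \<in> cbox (exponent_point a) (exponent_point a + One)"
      obtain q' where q': "q' \<in> D" "q = real k *\<^sub>R q'" using pq(3) by blast
      have "norm (z - exponent_point a) \<le> norm (One :: real ^ 'n)"
        using z by (intro norm_le_componentwise) (auto simp: mem_box algebra_simps)
      then have "norm (z - q) \<le> r"
        using pq(1,2) norm_triangle_ineq[of "z - exponent_point a" p] by (simp add: r_def)
      moreover have "z - q = real k *\<^sub>R (z /\<^sub>R real k - q')"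
        by (simp add: q' k_def scaleR_diff_right)
      ultimately have "real k * norm (z /\<^sub>R real k - q') \<le> r" by (metis norm_scaleR abs_of_nat)
      then have "norm (z /\<^sub>R real k - q') \<le> r / k"
        using \<open>0 < real k\<close> by (simp add: pos_le_divide_eq mult.commute)
      then have "z /\<^sub>R real k \<in> thickening D (r / k)"
        using infdist_le2[OF q'(1)] by (auto simp: thickening_def dist_norm)
      moreover have "z = real k *\<^sub>R (z /\<^sub>R real k)" by (simp add: k_def)
      ultimately show "z \<in> E" unfolding E_def by blast
    qed
    have "finite T"
    proof -
      obtain B where B: "\<And>x. x \<in> E \<Longrightarrow> norm x \<le> B"
        using compact_imp_bounded[OF \<open>compact E\<close>] by (auto simp: bounded_iff)
      have "a $ i \<le> nat \<lceil>B\<rceil>" if "a \<in> T" for a i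
      proof -
        have "exponent_point a \<in> cbox (exponent_point a) (exponent_point a + One)"
          by (simp add: mem_box inner_add_left)
        then have "norm (exponent_point a) \<le> B" using that B unfolding T_def by blast
        then have "real (a $ i) \<le> B"
          using component_le_norm_cart[of "exponent_point a" i] by (simp add: exponent_point_def)
        then show ?thesis by linarith
      qed
      then have "T \<subseteq> {a. \<forall>i. a $ i \<le> nat \<lceil>B\<rceil>}" by blast
      then show ?thesis by (rule finite_subset) (rule finite_bounded_exponents)
    qed
    have "finite A"
    proof (rule finite_subset[OF _ finite_bounded_exponents[of k]])
      have "a $ i \<le> (\<Sum>i\<in>UNIV. a $ i)" for a :: "nat ^ 'n" and i by (rule member_le_sum) auto
      then show "A \<subseteq> {a. \<forall>i. a $ i \<le> k}" by (auto simp: A_def intro: order_trans)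
    qed
    define m where "m a = (\<lambda>x. monom_fn \<alpha> x ^ (k - (\<Sum>i\<in>UNIV. a $ i)))" for a :: "nat ^ 'n"
    define P where "P = (\<lambda>(x, a) z. h x z * (\<Prod>i\<in>UNIV. g i z ^ (a $ i)) * m a z)"
    have P: "\<exists>M. P b = (\<lambda>z. \<Sum>\<tau>\<in>T. M \<tau> * monom_fn \<tau> z)" if b: "b \<in> X \<times> A" for b
    proof -
      obtain x a where xa: "b = (x, a)" "x \<in> X" "a \<in> A" using b by blast
      let ?s = "\<Sum>i\<in>UNIV. a $ i"
      have "(\<lambda>z. 1 * monom_fn \<alpha> z) \<in> polys_in D" by (rule polys_in_monom[OF D(3)])
      then have "monom_fn \<alpha> \<in> polys_in D" by simp
      then have "m a \<in> polys_in ((*\<^sub>R) (real (k - ?s)) ` D)"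
        unfolding m_def by (rule polys_in_power[OF D(2) \<open>D \<noteq> {}\<close>])
      moreover have "(\<lambda>z. \<Prod>i\<in>UNIV. g i z ^ (a $ i)) \<in> polys_in ((*\<^sub>R) (real ?s) ` D)"
        by (rule polys_in_prod_power[OF D(2) \<open>D \<noteq> {}\<close> supp]) simp
      ultimately have "(\<lambda>z. (\<Prod>i\<in>UNIV. g i z ^ (a $ i)) * m a z) \<in> polys_in ((*\<^sub>R) (real (?s + (k - ?s))) ` D)"
        by (intro polys_in_mult[OF _ _ dilate_add_mem[OF D(2)]])
      then have prod: "(\<lambda>z. (\<Prod>i\<in>UNIV. g i z ^ (a $ i)) * m a z) \<in> polys_in ((*\<^sub>R) (real k) ` D)"
        using xa(3) by (simp add: A_def)
      have "h x \<in> polys_in (cball 0 \<rho>)"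
        using \<rho>[OF xa(2)] by (intro polys_in_mono[OF h(1)]) auto
      then have "(\<lambda>z. h x z * ((\<Prod>i\<in>UNIV. g i z ^ (a $ i)) * m a z))
          \<in> polys_in {p + q | p q. p \<in> cball 0 \<rho> \<and> q \<in> (*\<^sub>R) (real k) ` D}"
        by (rule polys_in_mult[OF _ prod]) blast
      then have "\<exists>M. (\<lambda>z. h x z * ((\<Prod>i\<in>UNIV. g i z ^ (a $ i)) * m a z)) = (\<lambda>z. \<Sum>\<tau>\<in>T. M \<tau> * monom_fn \<tau> z)"
        by (rule polys_in_sum_superset[OF _ \<open>finite T\<close>]) (auto intro: mem_T)
      then show ?thesis by (simp add: xa(1) P_def mult.assoc)
    qed
    then obtain M where M: "\<And>b. b \<in> X \<times> A \<Longrightarrow> P b = (\<lambda>z. \<Sum>\<tau>\<in>T. M b \<tau> * monom_fn \<tau> z)" by metis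
    have "card (X \<times> A) \<le> card T"
    proof (rule ccontr)
      assume "\<not> card (X \<times> A) \<le> card T"
      then obtain c where c: "\<exists>b\<in>X \<times> A. c b \<noteq> 0" "\<And>\<tau>. \<tau> \<in> T \<Longrightarrow> (\<Sum>b\<in>X \<times> A. M b \<tau> * c b) = 0"
        using underdetermined_system[of T "X \<times> A" "\<lambda>\<tau> b. M b \<tau>"] \<open>finite T\<close> \<open>finite A\<close> X(1) by auto
      have rel: "(\<Sum>(x, a)\<in>X \<times> A. c (x, a) * (h x z * (\<Prod>i\<in>UNIV. g i z ^ (a $ i)) * m a z)) = 0" for z
      proof -
        have "(\<Sum>(x, a)\<in>X \<times> A. c (x, a) * (h x z * (\<Prod>i\<in>UNIV. g i z ^ (a $ i)) * m a z))
            = (\<Sum>b\<in>X \<times> A. c b * P b z)" by (simp add: P_def case_prod_beta)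
        also have "\<dots> = (\<Sum>b\<in>X \<times> A. \<Sum>\<tau>\<in>T. M b \<tau> * c b * monom_fn \<tau> z)"
          by (intro sum.cong refl) (simp add: M sum_distrib_left mult_ac)
        also have "\<dots> = (\<Sum>\<tau>\<in>T. (\<Sum>b\<in>X \<times> A. M b \<tau> * c b) * monom_fn \<tau> z)"
          by (subst sum.swap) (simp add: sum_distrib_right)
        also have "\<dots> = 0" using c(2) by simp
        finally show ?thesis .
      qed
      have "c (x, a) = 0" if "(x, a) \<in> X \<times> A" for x a
      proof (rule local_products_independent[OF X(1) \<open>finite A\<close> zero deriv nondeg _ h(2) h(3) _ _ rel that])
        show "continuous_on UNIV (h x)" for x using h(1) by (rule continuous_polys_in)
        show "continuous_on UNIV (m a)" for a
          unfolding m_def monom_fn_def by (intro continuous_intros)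
        show "m a x \<noteq> 0" if "x \<in> X" for a x
          using X(2) that monom_fn_nonzero by (auto simp: m_def)
      qed
      then show False using c(1) by auto
    qed
    then have "real (card X) * real (card A) \<le> real (card T)"
      by (metis card_cartesian_product of_nat_le_iff of_nat_mult)
    also have "\<dots> \<le> measure lborel E"
      by (rule card_exponents_le_measure[OF \<open>finite T\<close> \<open>compact E\<close>]) (simp add: T_def)
    also have "\<dots> = real k ^ CARD('n) * measure lborel (thickening D (r / k))"
      unfolding E_def by (subst measure_scaleR_image) (auto intro!: thickening_compact D \<open>D \<noteq> {}\<close>)
    finally have 1: "real (card X) * real (card A) \<le> real k ^ CARD('n) * measure lborel (thickening D (r / k))" .
    have "real (card X) * (real k ^ CARD('n) / fact CARD('n)) \<le> real (card X) * real (card A)"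
      unfolding A_def by (intro mult_left_mono card_exponents_degree_le) simp
    with 1 have "real k ^ CARD('n) * (real (card X) / fact CARD('n))
        \<le> real k ^ CARD('n) * measure lborel (thickening D (r / k))" by (simp add: mult_ac)
    then have "real (card X) / fact CARD('n) \<le> measure lborel (thickening D (r / k))"
      by (rule mult_left_le_imp_le) (simp add: k_def)
    then show ?thesis by (simp add: k_def)
  qed
  have "real (card X) / fact CARD('n) \<le> measure lborel D"
    using measure_thickening_tendsto[OF D(1) \<open>D \<noteq> {}\<close> \<open>0 \<le> r\<close>] bound
    by (intro LIMSEQ_le_const) auto
  then show ?thesis by (simp add: field_simps)
qed


section \<open>Sard's theorem for maps from a hypersurface to projective space\<close>

text \<open>
  In \<open>baby_Sard\<close> the coordinates are indexed by a well-ordered type.  An initial segment of the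
  natural numbers with as many elements as \<open>'n\<close> serves as such an index type.
\<close>

typedef ('n::finite) ordered_index = "{..<CARD('n)}"
  by (auto intro: exI[of _ 0])

instance ordered_index :: (finite) finite
proof
  have "finite (range (Rep_ordered_index :: 'a ordered_index \<Rightarrow> nat))"
    by (rule finite_subset[of _ "{..<CARD('a)}"]) (use Rep_ordered_index in auto)
  then show "finite (UNIV :: 'a ordered_index set)"
    by (rule finite_imageD) (simp add: inj_on_def Rep_ordered_index_inject)
qed

instantiation ordered_index :: (finite) wellorder
begin

definition "a \<le> b \<longleftrightarrow> Rep_ordered_index a \<le> Rep_ordered_index b"
definition "a < b \<longleftrightarrow> Rep_ordered_index a < Rep_ordered_index b"

instance
proof
  fix P :: "'a ordered_index \<Rightarrow> bool" and a
  assume step: "\<And>a. (\<And>b. b < a \<Longrightarrow> P b) \<Longrightarrow> P a"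
  show "P a"
    by (induction a rule: measure_induct_rule[of Rep_ordered_index])
       (use step in \<open>auto simp: less_ordered_index_def\<close>)
qed (auto simp: less_eq_ordered_index_def less_ordered_index_def Rep_ordered_index_inject)

end

lemma card_ordered_index: "CARD('n::finite ordered_index) = CARD('n)"
  using type_definition.card[OF type_definition_ordered_index[where 'n = 'n]] by simp

text \<open>
  Conjugating with a linear isomorphism reduces this to \<open>baby_Sard\<close>; linear isomorphisms preserve
  negligible sets and singularity of the derivative.
\<close>

lemma Sard_equal_dimensions:
  fixes f :: "real ^ 'n::finite \<Rightarrow> real ^ 'n"
  assumes deriv: "\<And>x. x \<in> S \<Longrightarrow> (f has_derivative f' x) (at x)"
    and singular: "\<And>x. x \<in> S \<Longrightarrow> \<exists>u. u \<noteq> 0 \<and> f' x u = 0"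
  shows "negligible (f ` S)"
proof -
  have "DIM(real ^ 'n ordered_index) = DIM(real ^ 'n)" by (simp add: card_ordered_index)
  then obtain \<phi> :: "real ^ 'n ordered_index \<Rightarrow> real ^ 'n" and \<psi>
    where iso: "linear \<phi>" "linear \<psi>" "\<And>x. \<psi> (\<phi> x) = x" "\<And>y. \<phi> (\<psi> y) = y"
    by (rule isomorphisms_UNIV_UNIV) blast
  have der: "(\<phi> has_derivative \<phi>) F" "(\<psi> has_derivative \<psi>) G" for F G
    using iso by (auto intro: linear_imp_has_derivative)
  let ?F = "\<lambda>x. \<psi> (f (\<phi> x))" and ?F' = "\<lambda>x u. \<psi> (f' (\<phi> x) (\<phi> u))"
  have "negligible (?F ` (\<phi> -` S))"
  proof (rule baby_Sard[where f' = ?F'])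
    fix x assume x: "x \<in> \<phi> -` S"
    have "(f has_derivative f' (\<phi> x)) (at (\<phi> x))" using x by (intro deriv) simp
    then show d: "(?F has_derivative ?F' x) (at x within \<phi> -` S)"
      by (intro has_derivative_compose[OF has_derivative_compose[OF der(1)] der(2)])
    obtain u where u: "u \<noteq> 0" "f' (\<phi> x) u = 0" using singular x by blast
    have lin: "linear (?F' x)" using d by (rule has_derivative_linear)
    have "\<psi> u \<noteq> 0" using u(1) iso by (metis linear_0)
    moreover have "?F' x (\<psi> u) = 0" using u(2) iso by (simp add: linear_0)
    ultimately have "\<not> inj (?F' x)" using linear_injective_0[OF lin] by blast
    then have "\<not> inj ((*v) (matrix (?F' x)))" using lin by (simp add: matrix_works)
    then have "rank (matrix (?F' x)) \<noteq> CARD('n ordered_index)"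
      using full_rank_injective by blast
    moreover have "rank (matrix (?F' x)) \<le> CARD('n ordered_index)"
      using rank_bound[of "matrix (?F' x)"] by simp
    ultimately show "rank (matrix (?F' x)) < CARD('n ordered_index)" by simp
  qed simp
  then have "negligible (\<phi> ` (?F ` (\<phi> -` S)))"
    by (rule negligible_differentiable_image_negligible[rotated])
       (auto simp: card_ordered_index intro!: linear_imp_differentiable_on iso)
  moreover have "\<phi> ` (?F ` (\<phi> -` S)) = f ` S"
  proof -
    have "f y \<in> \<phi> ` (?F ` (\<phi> -` S))" if "y \<in> S" for y
      using that iso(3,4) by (intro image_eqI[of _ _ "\<psi> (f y)"] image_eqI[of _ _ "\<psi> y"]) auto
    then show ?thesis using iso(4) by auto
  qed
  ultimately show ?thesis by simp
qed

text \<open>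
  This is Sard's theorem, near \<open>x\<^sub>0\<close>, for the map \<open>[\<Theta>]\<close> from the hypersurface \<open>G = 0\<close> to projective
  space.  The set of critical values is represented by the cone over it, so that Lebesgue measure
  applies and projective space needs no charts.

  If \<open>\<partial>G/\<partial>e \<noteq> 0\<close> at \<open>x\<^sub>0\<close>, replacing the coordinate of \<open>x\<close> along \<open>e\<close> by \<open>G x\<close> is a local diffeomorphism
  \<open>E\<close>, which straightens the hypersurface to the hyperplane \<open>y \<bullet> e = 0\<close>.  This leaves the coordinate
  along \<open>e\<close> free to parametrise the lines of the cone: the cone is the image of the equidimensional
  map \<open>P y = (y \<bullet> e) \<Theta> (g (\<pi> y))\<close>, where \<open>\<pi>\<close> is the projection to the hyperplane and \<open>g\<close> the inverse of
  \<open>E\<close>.  At a point over \<open>x \<in> K\<close>, with \<open>u\<close> tangent to the hypersurface and \<open>\<Theta>' u = l \<Theta>\<close>, the derivative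
  of \<open>P\<close> kills the vector \<open>\<pi> u - (y \<bullet> e) l e\<close>, so Sard's theorem applies.
\<close>

lemma negligible_critical_cone_local:
  fixes G :: "real ^ 'n::finite \<Rightarrow> real" and \<Theta> :: "real ^ 'n \<Rightarrow> real ^ 'n"
  assumes U: "open U"
    and dG: "\<And>x. x \<in> U \<Longrightarrow> (G has_derivative G' x) (at x)"
    and contG: "\<And>u. continuous_on U (\<lambda>x. G' x u)"
    and dT: "\<And>x. x \<in> U \<Longrightarrow> (\<Theta> has_derivative \<Theta>' x) (at x)"
    and K: "K \<subseteq> U" "\<And>x. x \<in> K \<Longrightarrow> G x = 0"
      "\<And>x. x \<in> K \<Longrightarrow> \<exists>u. u \<noteq> 0 \<and> G' x u = 0 \<and> (\<exists>l. \<Theta>' x u = l *\<^sub>R \<Theta> x)"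
    and x0: "x0 \<in> U" "G' x0 v \<noteq> 0"
  shows "\<exists>W. open W \<and> x0 \<in> W \<and> negligible {s *\<^sub>R \<Theta> x | s x. x \<in> K \<inter> W}"
proof -
  have lin: "linear (G' x)" if "x \<in> U" for x using dG[OF that] by (rule has_derivative_linear)
  obtain e where e: "e \<in> Basis" "G' x0 e \<noteq> 0"
  proof -
    have "\<not> (\<forall>e\<in>Basis. G' x0 e = 0)"
      using linear_eq_on_span[OF lin[OF x0(1)] linear_zero, of Basis v] x0(2)
      by (metis UNIV_I span_Basis)
    then show ?thesis using that by blast
  qed
  have ee: "e \<bullet> e = 1" using e(1) by (simp add: inner_Basis)
  define \<pi> where "\<pi> y = y - (y \<bullet> e) *\<^sub>R e" for y :: "real ^ 'n"
  define E where "E x = x + (G x - x \<bullet> e) *\<^sub>R e" for x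
  define E'fun where "E'fun x u = u + (G' x u - u \<bullet> e) *\<^sub>R e" for x u
  define E' where "E' x = Blinfun (E'fun x)" for x
  have dE: "(E has_derivative E'fun x) (at x)" if "x \<in> U" for x
    unfolding E_def E'fun_def by (auto intro!: derivative_eq_intros dG that)
  have E'_apply: "blinfun_apply (E' x) = E'fun x" if "x \<in> U" for x
    unfolding E'_def using has_derivative_bounded_linear[OF dE[OF that]]
    by (rule bounded_linear_Blinfun_apply)
  have dE_blinfun: "(E has_derivative blinfun_apply (E' x)) (at x)" if "x \<in> U" for x
    using dE[OF that] by (simp add: E'_apply that)
  have linE: "linear (E'fun x)" if "x \<in> U" for x using dE[OF that] by (rule has_derivative_linear)
  have E'_inj: "u = 0" if "E'fun x0 u = 0" for u
  proof -
    define r where "r = u \<bullet> e - G' x0 u"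
    have u: "u = r *\<^sub>R e" using that by (simp add: E'fun_def r_def algebra_simps)
    then have "u \<bullet> e = r" using ee by simp
    then have "G' x0 u = 0" by (simp add: r_def)
    then have "r * G' x0 e = 0" using u lin[OF x0(1)] by (metis linear_cmul real_scaleR_def)
    then show ?thesis using u e(2) by simp
  qed
  then have "inj (E'fun x0)" using linear_injective_0[OF linE[OF x0(1)]] by blast
  then obtain L where L: "linear L" "L \<circ> E'fun x0 = id"
    using linear_injective_left_inverse[OF linE[OF x0(1)]] by blast
  have inv: "Blinfun L o\<^sub>L E' x0 = id_blinfun"
  proof (rule blinfun_eqI)
    fix i
    have "bounded_linear L" using L(1) by (simp add: linear_conv_bounded_linear)
    then show "blinfun_apply (Blinfun L o\<^sub>L E' x0) i = blinfun_apply id_blinfun i"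
      using L(2) by (simp add: E'_apply x0 bounded_linear_Blinfun_apply fun_eq_iff)
  qed
  have cont: "continuous_on U E'"
  proof (rule continuous_on_blinfun_componentwise)
    fix i :: "real ^ 'n"
    have "continuous_on U (\<lambda>x. E'fun x i)"
      unfolding E'fun_def by (intro continuous_intros contG)
    then show "continuous_on U (\<lambda>x. blinfun_apply (E' x) i)"
      by (rule continuous_on_eq) (simp add: E'_apply)
  qed
  obtain W V g g' where W: "homeomorphism W V E g" "open W" "x0 \<in> W"
    and dg: "\<And>y. y \<in> V \<Longrightarrow> (g has_derivative g' y) (at y)"
    and g': "\<And>y. y \<in> V \<Longrightarrow> g' y = inv (blinfun_apply (E' (g y)))"
    and bij: "\<And>y. y \<in> V \<Longrightarrow> bij (blinfun_apply (E' (g y)))"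
    by (rule inverse_function_theorem[OF U dE_blinfun cont x0(1) inv], assumption) (elim that)
  define S where "S = {y. \<pi> y \<in> V \<and> g (\<pi> y) \<in> K}"
  define P where "P y = (y \<bullet> e) *\<^sub>R \<Theta> (g (\<pi> y))" for y
  define P' where "P' y u = (y \<bullet> e) *\<^sub>R \<Theta>' (g (\<pi> y)) (g' (\<pi> y) (\<pi> u)) + (u \<bullet> e) *\<^sub>R \<Theta> (g (\<pi> y))" for y u
  have gW: "g y \<in> W" "E (g y) = y" if "y \<in> V" for y
    using W(1) that by (auto simp: homeomorphism_def)
  have linpi: "linear \<pi>"
    by (auto simp: linear_iff \<pi>_def inner_add_left algebra_simps)
  have "negligible (P ` S)"
  proof (rule Sard_equal_dimensions)
    fix y assume y: "y \<in> S"
    let ?x = "g (\<pi> y)"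
    have yV: "\<pi> y \<in> V" and xK: "?x \<in> K" using y by (auto simp: S_def)
    have xU: "?x \<in> U" using K(1) xK by blast
    have "(\<pi> has_derivative \<pi>) (at y)" using linpi by (rule linear_imp_has_derivative)
    from has_derivative_compose[OF has_derivative_compose[OF this dg[OF yV]] dT[OF xU]]
    have "((\<lambda>y. \<Theta> (g (\<pi> y))) has_derivative (\<lambda>u. \<Theta>' ?x (g' (\<pi> y) (\<pi> u)))) (at y)" .
    from has_derivative_scaleR[OF has_derivative_inner_left[OF has_derivative_ident] this]
    show "(P has_derivative P' y) (at y)" unfolding P_def P'_def by simp
    obtain u l where u: "u \<noteq> 0" "G' ?x u = 0" "\<Theta>' ?x u = l *\<^sub>R \<Theta> ?x" using K(3)[OF xK] by blast
    have E'u: "E'fun ?x u = \<pi> u" using u(2) by (simp add: E'fun_def \<pi>_def)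
    have bijE: "bij (E'fun ?x)" using bij[OF yV] xU by (simp add: E'_apply)
    have g'u: "g' (\<pi> y) (\<pi> u) = u"
      using bijE xU by (simp add: g'[OF yV] E'_apply flip: E'u) (simp add: bij_is_inj)
    define w where "w = \<pi> u - ((y \<bullet> e) * l) *\<^sub>R e"
    have piw: "\<pi> w = \<pi> u" and we: "w \<bullet> e = - ((y \<bullet> e) * l)"
      using ee by (simp_all add: w_def \<pi>_def inner_diff_left)
    have "P' y w = 0" by (simp add: P'_def piw we g'u u(3))
    moreover have "w \<noteq> 0"
    proof
      assume "w = 0"
      then have "\<pi> u = 0" using piw linear_0[OF linpi] by simp
      then have "E'fun ?x u = E'fun ?x 0" using E'u linear_0[OF linE[OF xU]] by simp
      then show False using bijE u(1) by (auto dest!: bij_is_inj injD)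
    qed
    ultimately show "\<exists>u. u \<noteq> 0 \<and> P' y u = 0" by blast
  qed
  moreover have "{s *\<^sub>R \<Theta> x | s x. x \<in> K \<inter> W} \<subseteq> P ` S"
  proof clarify
    fix s x assume x: "x \<in> K" "x \<in> W"
    define y where "y = E x + s *\<^sub>R e"
    have Ex: "E x = \<pi> x" using K(2)[OF x(1)] by (simp add: E_def \<pi>_def)
    have "\<pi> y = E x" "y \<bullet> e = s" using ee by (simp_all add: y_def Ex \<pi>_def inner_diff_left inner_add_left algebra_simps)
    moreover have "E x \<in> V" "g (E x) = x" using W(1) x(2) by (auto simp: homeomorphism_def)
    ultimately have "y \<in> S" "P y = s *\<^sub>R \<Theta> x" using x(1) by (auto simp: S_def P_def)
    then show "s *\<^sub>R \<Theta> x \<in> P ` S" by (metis imageI)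
  qed
  ultimately have "negligible {s *\<^sub>R \<Theta> x | s x. x \<in> K \<inter> W}" by (rule negligible_subset)
  then show ?thesis using W(2,3) by blast
qed

text \<open>
  By Lindelof's theorem, countably many of the neighbourhoods from the local version suffice.
\<close>

lemma negligible_critical_cone:
  fixes G :: "real ^ 'n::finite \<Rightarrow> real" and \<Theta> :: "real ^ 'n \<Rightarrow> real ^ 'n"
  assumes U: "open U"
    and dG: "\<And>x. x \<in> U \<Longrightarrow> (G has_derivative G' x) (at x)"
    and contG: "\<And>u. continuous_on U (\<lambda>x. G' x u)"
    and dT: "\<And>x. x \<in> U \<Longrightarrow> (\<Theta> has_derivative \<Theta>' x) (at x)"
    and K: "K \<subseteq> U" "\<And>x. x \<in> K \<Longrightarrow> G x = 0" "\<And>x. x \<in> K \<Longrightarrow> \<exists>v. G' x v \<noteq> 0"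
      "\<And>x. x \<in> K \<Longrightarrow> \<exists>u. u \<noteq> 0 \<and> G' x u = 0 \<and> (\<exists>l. \<Theta>' x u = l *\<^sub>R \<Theta> x)"
  shows "negligible {s *\<^sub>R \<Theta> x | s x. x \<in> K}"
proof -
  define C where "C W = {s *\<^sub>R \<Theta> x | s x. x \<in> K \<inter> W}" for W
  let ?F = "{W. open W \<and> negligible (C W)}"
  obtain F where F: "F \<subseteq> ?F" "countable F" "\<Union>F = \<Union>?F"
    by (rule Lindelof[of ?F]) auto
  have "\<exists>W\<in>F. x \<in> W" if x: "x \<in> K" for x
  proof -
    obtain v where "G' x v \<noteq> 0" using K(3)[OF x] by blast
    then have "\<exists>W. open W \<and> x \<in> W \<and> negligible (C W)" unfolding C_def
      using K x by (intro negligible_critical_cone_local[OF U dG contG dT]) auto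
    then show ?thesis using F(3) by blast
  qed
  then have "{s *\<^sub>R \<Theta> x | s x. x \<in> K} \<subseteq> (\<Union>W\<in>F. C W)" unfolding C_def by blast
  moreover have "negligible (\<Union>W\<in>F. C W)"
    using F(1,2) by (intro negligible_countable_Union) auto
  ultimately show ?thesis by (rule negligible_subset[rotated])
qed


section \<open>The logarithmic Gauss map and its critical points\<close>

definition poly_fn :: "(nat ^ 'n) set \<Rightarrow> (nat ^ 'n \<Rightarrow> real) \<Rightarrow> real ^ 'n::finite \<Rightarrow> real" where
  "poly_fn S c x = (\<Sum>a\<in>S. c a * monom_fn a x)"

text \<open>
  On the torus the derivatives are written in terms of the logarithmic direction \<open>u\<^sub>i / x\<^sub>i\<close>: the
  logarithmic partial derivative \<open>x\<^sub>i \<partial>/\<partial>x\<^sub>i\<close> only multiplies the coefficient of \<open>x\<^sup>a\<close> by \<open>a\<^sub>i\<close>, and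
  therefore does not enlarge the Newton polytope.
\<close>

lemma monom_fn_has_derivative:
  assumes "x \<in> alg_torus"
  shows "(monom_fn a has_derivative (\<lambda>u. \<Sum>i\<in>UNIV. u $ i / x $ i * (real (a $ i) * monom_fn a x))) (at x)"
proof -
  have xi: "x $ i \<noteq> 0" for i using assms by (simp add: alg_torus_def)
  have nth: "((\<lambda>x. x $ i) has_derivative (\<lambda>u. u $ i)) (at x)" for i
    by (rule bounded_linear_imp_has_derivative) (rule bounded_linear_vec_nth)
  have "((\<lambda>x. \<Prod>i\<in>UNIV. (x $ i) ^ (a $ i)) has_derivative
      (\<lambda>u. \<Sum>i\<in>UNIV. (real (a $ i) * u $ i * (x $ i) ^ (a $ i - 1)) * (\<Prod>j\<in>UNIV - {i}. (x $ j) ^ (a $ j)))) (at x)"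
    by (intro has_derivative_prod has_derivative_power nth)
  moreover have "(real (a $ i) * u $ i * (x $ i) ^ (a $ i - 1)) * (\<Prod>j\<in>UNIV - {i}. (x $ j) ^ (a $ j))
      = u $ i / x $ i * (real (a $ i) * monom_fn a x)" for u i
  proof (cases "a $ i = 0")
    case False
    then have "(x $ i) ^ (a $ i) = x $ i * (x $ i) ^ (a $ i - 1)" by (simp add: power_eq_if)
    moreover have "monom_fn a x = (x $ i) ^ (a $ i) * (\<Prod>j\<in>UNIV - {i}. (x $ j) ^ (a $ j))"
      unfolding monom_fn_def by (rule prod.remove) auto
    ultimately show ?thesis using xi[of i] by simp
  qed simp
  ultimately show ?thesis unfolding monom_fn_def[abs_def] by simp
qed

lemma poly_fn_has_derivative:
  assumes "x \<in> alg_torus"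
  shows "(poly_fn S c has_derivative
    (\<lambda>u. \<Sum>i\<in>UNIV. u $ i / x $ i * poly_fn S (\<lambda>a. real (a $ i) * c a) x)) (at x)"
proof -
  have "((\<lambda>x. \<Sum>a\<in>S. c a * monom_fn a x) has_derivative
      (\<lambda>u. \<Sum>a\<in>S. c a * (\<Sum>i\<in>UNIV. u $ i / x $ i * (real (a $ i) * monom_fn a x)))) (at x)"
    by (intro has_derivative_sum has_derivative_mult_right monom_fn_has_derivative assms)
  moreover have "(\<Sum>a\<in>S. c a * (\<Sum>i\<in>UNIV. u $ i / x $ i * (real (a $ i) * monom_fn a x)))
      = (\<Sum>i\<in>UNIV. u $ i / x $ i * poly_fn S (\<lambda>a. real (a $ i) * c a) x)" for u
    unfolding poly_fn_def sum_distrib_left by (subst sum.swap) (simp add: mult_ac)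
  ultimately show ?thesis unfolding poly_fn_def[abs_def] by simp
qed

lemma continuous_on_poly_fn [continuous_intros]:
  assumes "continuous_on A f"
  shows "continuous_on A (\<lambda>z. poly_fn S c (f z))"
  unfolding poly_fn_def monom_fn_def by (intro continuous_intros assms)

lemma poly_fn_linear_combination:
  "poly_fn S (\<lambda>a. (r * p a - s * q a) * c a) x = r * poly_fn S (\<lambda>a. p a * c a) x - s * poly_fn S (\<lambda>a. q a * c a) x"
  unfolding poly_fn_def sum_distrib_left sum_subtractf[symmetric] by (simp add: algebra_simps)

lemma mp_eval_superset:
  assumes "finite T" "Poly_Mapping.keys G \<subseteq> T"
  shows "mp_eval G x = poly_fn T (Poly_Mapping.lookup G) x"
  unfolding mp_eval_def poly_fn_def monom_fn_def
  by (intro sum.mono_neutral_left assms) (auto simp: in_keys_iff)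

lemma mp_eval_eq_poly_fn: "mp_eval G x = poly_fn (Poly_Mapping.keys G) (Poly_Mapping.lookup G) x"
  by (rule mp_eval_superset) auto

lemma mp_eval_add: "mp_eval (p + q) x = mp_eval p x + mp_eval q (x :: real ^ 'n::finite)"
proof -
  let ?T = "Poly_Mapping.keys p \<union> Poly_Mapping.keys q"
  have "Poly_Mapping.keys (p + q) \<subseteq> ?T" by (rule Poly_Mapping.keys_add)
  then show ?thesis
    by (simp add: mp_eval_superset[of ?T] poly_fn_def lookup_add distrib_right sum.distrib)
qed

lemma mp_eval_single: "mp_eval (Poly_Mapping.single a k) x = k * monom_fn a (x :: real ^ 'n::finite)"
  by (simp add: mp_eval_superset[of "{a}"] poly_fn_def)

lemma mp_eval_sum_single:
  fixes x :: "real ^ 'n::finite"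
  assumes "finite A"
  shows "mp_eval (\<Sum>b\<in>A. Poly_Mapping.single (e b) (k b)) x = (\<Sum>b\<in>A. k b * monom_fn (e b) x)"
  using assms
proof (induction A rule: finite_induct)
  case empty
  show ?case by (simp add: mp_eval_def)
qed (simp add: mp_eval_add mp_eval_single)

lemma log_partial_eq_poly_fn:
  fixes x :: "real ^ 'n::finite"
  shows "x $ i * mp_eval (mp_partial i G) x
    = poly_fn (Poly_Mapping.keys G) (\<lambda>a. real (a $ i) * Poly_Mapping.lookup G a) x"
proof -
  have lower: "x $ i * (real (a $ i) * monom_fn (a - axis i 1) x) = real (a $ i) * monom_fn a x" for a
  proof (cases "a $ i = 0")
    case False
    then have "a = (a - axis i 1) + axis i 1" by (auto simp: vec_eq_iff axis_def)
    then have "monom_fn a x = monom_fn (a - axis i 1) x * x $ i" by (metis monom_fn_add monom_fn_axis)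
    then show ?thesis by simp
  qed simp
  have "x $ i * (real (a $ i) * k * monom_fn (a - axis i 1) x) = real (a $ i) * k * monom_fn a x" for a k
  proof -
    have "x $ i * (real (a $ i) * k * monom_fn (a - axis i 1) x)
        = k * (x $ i * (real (a $ i) * monom_fn (a - axis i 1) x))" by (simp only: mult_ac)
    then show ?thesis unfolding lower by (simp only: mult_ac)
  qed
  then show ?thesis
    unfolding mp_partial_def poly_fn_def mp_eval_sum_single[OF finite_keys] sum_distrib_left
    by (simp only:)
qed

lemma open_alg_torus: "open (alg_torus :: (real ^ 'n::finite) set)"
proof -
  have eq: "alg_torus = (\<Inter>i\<in>UNIV. {x :: real ^ 'n. x $ i \<noteq> 0})" by (auto simp: alg_torus_def)
  show ?thesis unfolding eq
    by (intro open_INT finite_class.finite_UNIV ballI open_Collect_neq continuous_intros)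
qed

text \<open>
  The intersection of an open and a closed set is a countable union of compact sets.
\<close>

lemma borel_image_locally_closed:
  fixes f :: "'a::euclidean_space \<Rightarrow> 'b::t2_space"
  assumes "open O1" "closed C" "continuous_on O1 f"
  shows "f ` (O1 \<inter> C) \<in> sets borel"
proof -
  obtain K :: "nat \<Rightarrow> 'a set" where K: "\<And>n. compact (K n)" "\<And>n. K n \<subseteq> O1" "\<Union>(range K) = O1"
    by (rule open_Union_compact_subsets[OF assms(1)]) (elim that)
  have eq: "f ` (O1 \<inter> C) = (\<Union>n. f ` (K n \<inter> C))" using K(3) by blast
  have "compact (f ` (K n \<inter> C))" for n
    using K(1,2) assms by (intro compact_continuous_image compact_Int_closed)
      (auto intro: continuous_on_subset)
  then show ?thesis unfolding eq by (intro sets.countable_UN) (auto intro: borel_compact)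
qed

definition log_grad :: "('n::finite, real) mpoly \<Rightarrow> real ^ 'n \<Rightarrow> real ^ 'n" where
  "log_grad G x = (\<chi> i. poly_fn (Poly_Mapping.keys G) (\<lambda>a. real (a $ i) * Poly_Mapping.lookup G a) x)"

text \<open>
  The derivative of the logarithmic gradient in the logarithmic direction \<open>w\<close>.
\<close>

definition log_hess :: "('n::finite, real) mpoly \<Rightarrow> real ^ 'n \<Rightarrow> real ^ 'n \<Rightarrow> real ^ 'n" where
  "log_hess G x w = (\<chi> j. \<Sum>i\<in>UNIV. w $ i *
     poly_fn (Poly_Mapping.keys G) (\<lambda>a. real (a $ i) * (real (a $ j) * Poly_Mapping.lookup G a)) x)"

lemma log_gauss_map_eq: "log_gauss_map G x = span {log_grad G x}"
  by (simp add: log_gauss_map_def log_grad_def log_partial_eq_poly_fn)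

lemma continuous_on_log_grad [continuous_intros]:
  "continuous_on A f \<Longrightarrow> continuous_on A (\<lambda>z. log_grad G (f z))"
  unfolding log_grad_def by (intro continuous_intros)

lemma continuous_on_log_hess [continuous_intros]:
  "continuous_on A f \<Longrightarrow> continuous_on A h \<Longrightarrow> continuous_on A (\<lambda>z. log_hess G (f z) (h z))"
  unfolding log_hess_def by (intro continuous_intros)

text \<open>
  The condition on \<open>w\<close> says that, in logarithmic coordinates, \<open>w\<close> is tangent to the hypersurface and
  annihilated by the derivative of the Gauss map.  Points where the logarithmic gradient vanishes
  are excluded since the Gauss map has no value in projective space there.
\<close>

definition critical_points :: "('n::finite, real) mpoly \<Rightarrow> (real ^ 'n) set" where
  "critical_points G = {x \<in> real_hypersurface G. log_grad G x \<noteq> 0 \<and>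
     (\<exists>w l. w \<noteq> 0 \<and> w \<bullet> log_grad G x = 0 \<and> log_hess G x w = l *\<^sub>R log_grad G x)}"

lemma negligible_critical_directions:
  "negligible {s *\<^sub>R log_grad G x | s x. x \<in> critical_points G}"
proof -
  let ?S = "Poly_Mapping.keys G" and ?c = "Poly_Mapping.lookup G"
  let ?log = "\<lambda>x u. \<chi> i. u $ i / x $ i"
  show ?thesis
  proof (rule negligible_critical_cone[OF open_alg_torus,
        where G = "mp_eval G" and G' = "\<lambda>x u. ?log x u \<bullet> log_grad G x"
          and \<Theta>' = "\<lambda>x u. log_hess G x (?log x u)"])
    fix x :: "real ^ 'a" assume x: "x \<in> alg_torus"
    show "(mp_eval G has_derivative (\<lambda>u. ?log x u \<bullet> log_grad G x)) (at x)"
      using poly_fn_has_derivative[OF x, of ?S ?c]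
      by (simp add: inner_vec_def log_grad_def mp_eval_eq_poly_fn[abs_def])
    show "(log_grad G has_derivative (\<lambda>u. log_hess G x (?log x u))) (at x)"
      unfolding has_derivative_componentwise_within[of "log_grad G"]
      using poly_fn_has_derivative[OF x]
      by (auto simp: Basis_vec_def inner_axis log_grad_def log_hess_def)
  next
    show "continuous_on alg_torus (\<lambda>x. ?log x u \<bullet> log_grad G x)" for u :: "real ^ 'a"
      by (intro continuous_intros) (simp add: alg_torus_def)
    show "critical_points G \<subseteq> alg_torus" "\<And>x. x \<in> critical_points G \<Longrightarrow> mp_eval G x = 0"
      by (auto simp: critical_points_def real_hypersurface_def)
  next
    fix x assume x: "x \<in> critical_points G"
    then have xi: "x $ i \<noteq> 0" for i by (simp add: critical_points_def real_hypersurface_def alg_torus_def)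
    define u where "u w = (\<chi> i. x $ i * w $ i)" for w :: "real ^ 'a"
    have log_u: "?log x (u w) = w" for w using xi by (simp add: u_def vec_eq_iff)
    have "log_grad G x \<noteq> 0" using x by (simp add: critical_points_def)
    then show "\<exists>v. ?log x v \<bullet> log_grad G x \<noteq> 0"
      by (intro exI[of _ "u (log_grad G x)"]) (simp add: log_u)
    obtain w l where w: "w \<noteq> 0" "w \<bullet> log_grad G x = 0" "log_hess G x w = l *\<^sub>R log_grad G x"
      using x by (auto simp: critical_points_def)
    have "u w \<noteq> 0"
    proof
      assume "u w = 0"
      then have "w = ?log x 0" using log_u[of w] by simp
      then show False using w(1) by (simp add: vec_eq_iff)
    qed
    then show "\<exists>u. u \<noteq> 0 \<and> ?log x u \<bullet> log_grad G x = 0 \<and> (\<exists>l. log_hess G x (?log x u) = l *\<^sub>R log_grad G x)"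
      using w by (intro exI[of _ "u w"]) (auto simp: log_u)
  qed
qed

text \<open>
  The critical points are the projection of the set of triples \<open>(x, w, l)\<close> that satisfy the equations
  defining them.  Normalising \<open>w\<close> to unit length makes this set locally closed, so that its image
  under a continuous map is a Borel set.
\<close>

lemma critical_directions_borel:
  "(\<lambda>x. r *\<^sub>R sgn (log_grad G x)) ` critical_points G \<in> sets borel"
proof -
  let ?O = "{z :: (real ^ 'a) \<times> (real ^ 'a) \<times> real. fst z \<in> alg_torus \<and> log_grad G (fst z) \<noteq> 0}"
  let ?C = "{z :: (real ^ 'a) \<times> (real ^ 'a) \<times> real. mp_eval G (fst z) = 0 \<and> norm (fst (snd z)) = 1 \<and>
    fst (snd z) \<bullet> log_grad G (fst z) = 0 \<and>
    log_hess G (fst z) (fst (snd z)) = snd (snd z) *\<^sub>R log_grad G (fst z)}"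
  let ?f = "\<lambda>z :: (real ^ 'a) \<times> (real ^ 'a) \<times> real. r *\<^sub>R sgn (log_grad G (fst z))"
  have "open ?O"
    by (intro open_Collect_conj open_Collect_neq continuous_intros)
       (auto intro: open_vimage_fst[OF open_alg_torus, unfolded vimage_def])
  moreover have "closed ?C" unfolding mp_eval_eq_poly_fn
    by (intro closed_Collect_conj closed_Collect_eq continuous_intros)
  moreover have "continuous_on ?O ?f"
    unfolding sgn_div_norm by (intro continuous_intros) auto
  ultimately have "?f ` (?O \<inter> ?C) \<in> sets borel" by (rule borel_image_locally_closed)
  moreover have "fst ` (?O \<inter> ?C) = critical_points G"
  proof
    show "fst ` (?O \<inter> ?C) \<subseteq> critical_points G"
    proof clarsimp
      fix x w l assume x: "x \<in> alg_torus" "log_grad G x \<noteq> 0" "mp_eval G x = 0"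
        and w: "norm w = 1" "w \<bullet> log_grad G x = 0" "log_hess G x w = l *\<^sub>R log_grad G x"
      have "w \<noteq> 0" using w(1) by auto
      then show "x \<in> critical_points G"
        unfolding critical_points_def real_hypersurface_def using x w by blast
    qed
    show "critical_points G \<subseteq> fst ` (?O \<inter> ?C)"
    proof
      fix x assume x: "x \<in> critical_points G"
      then obtain w l where w: "w \<noteq> 0" "w \<bullet> log_grad G x = 0" "log_hess G x w = l *\<^sub>R log_grad G x"
        by (auto simp: critical_points_def)
      have "log_hess G x (sgn w) = (l / norm w) *\<^sub>R log_grad G x"
      proof -
        have "log_hess G x (sgn w) = (1 / norm w) *\<^sub>R log_hess G x w"
          by (simp add: log_hess_def sgn_div_norm vec_eq_iff sum_distrib_left mult_ac divide_inverse)
        then show ?thesis by (simp add: w(3))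
      qed
      then have "(x, sgn w, l / norm w) \<in> ?O \<inter> ?C"
        using x w by (auto simp: critical_points_def real_hypersurface_def norm_sgn sgn_div_norm)
      then show "x \<in> fst ` (?O \<inter> ?C)" by (rule image_eqI[rotated]) simp
    qed
  qed
  moreover have "?f ` (?O \<inter> ?C) = (\<lambda>x. r *\<^sub>R sgn (log_grad G x)) ` (fst ` (?O \<inter> ?C))"
    by (simp only: image_image)
  ultimately show ?thesis by simp
qed


section \<open>Bounding the total curvature\<close>

definition critical_values :: "('n::finite, real) mpoly \<Rightarrow> (real ^ 'n) set set" where
  "critical_values G = log_gauss_map G ` critical_points G"

lemma span_unit_eq_iff:
  fixes v z :: "'a::real_inner"
  assumes "norm v = 1" "z \<noteq> 0"
  shows "span {v} = span {z} \<longleftrightarrow> v = sgn z \<or> v = - sgn z"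
proof
  assume "span {v} = span {z}"
  then have "v \<in> span {z}" using span_base[of v "{v}"] by simp
  then obtain k where k: "v = k *\<^sub>R z" by (auto simp: span_singleton)
  then have "\<bar>k\<bar> = 1 / norm z" using assms by (simp add: field_simps)
  then have "k = 1 / norm z \<or> k = - (1 / norm z)" by linarith
  then show "v = sgn z \<or> v = - sgn z" by (auto simp: k sgn_div_norm divide_inverse)
next
  have "span {k *\<^sub>R z} = span {z}" if "k \<noteq> 0" for k
  proof
    have "k *\<^sub>R z \<in> span {z}" by (intro span_scale span_base) simp
    then show "span {k *\<^sub>R z} \<subseteq> span {z}" by (intro span_minimal subspace_span) simp
    have "(1 / k) *\<^sub>R (k *\<^sub>R z) \<in> span {k *\<^sub>R z}" by (intro span_scale span_base) simp
    then have "z \<in> span {k *\<^sub>R z}" using that by simp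
    then show "span {z} \<subseteq> span {k *\<^sub>R z}" by (intro span_minimal subspace_span) simp
  qed
  from this[of "inverse (norm z)"] this[of "- inverse (norm z)"]
  show "v = sgn z \<or> v = - sgn z \<Longrightarrow> span {v} = span {z}" using assms by (auto simp: sgn_div_norm)
qed

text \<open>
  The preimage of the critical values on the sphere consists of the directions \<open>\<plusminus> sgn \<theta>(x)\<close> with \<open>x\<close>
  critical.  It is a Borel set, and its area is, up to a constant factor, the volume of a part of
  the negligible cone over it.
\<close>

lemma critical_values_null:
  "critical_values G \<in> null_sets (RP_measure :: (real ^ 'n::finite) set measure)"
proof -
  let ?g = "\<lambda>r x. r *\<^sub>R sgn (log_grad G x)"
  define A where "A = ?g 1 ` critical_points G \<union> ?g (- 1) ` critical_points G"
  have A_borel: "A \<in> sets borel" unfolding A_def by (intro sets.Un critical_directions_borel)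
  have crit: "log_grad G x \<noteq> 0" if "x \<in> critical_points G" for x
    using that by (simp add: critical_points_def)
  have A_sphere: "A \<subseteq> sphere 0 1" using crit by (auto simp: A_def norm_sgn)
  have A_eq: "{v \<in> sphere 0 1. span {v} \<in> critical_values G} = A"
  proof -
    have "span {v} \<in> critical_values G \<longleftrightarrow> v \<in> A" if v: "v \<in> sphere 0 1" for v
    proof -
      have "span {v} \<in> critical_values G \<longleftrightarrow> (\<exists>x\<in>critical_points G. span {v} = span {log_grad G x})"
        by (auto simp: critical_values_def log_gauss_map_eq)
      also have "\<dots> \<longleftrightarrow> (\<exists>x\<in>critical_points G. v = sgn (log_grad G x) \<or> v = - sgn (log_grad G x))"
        using v crit by (intro bex_cong refl span_unit_eq_iff) auto
      also have "\<dots> \<longleftrightarrow> v \<in> A" by (auto simp: A_def)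
      finally show ?thesis .
    qed
    then show ?thesis using A_sphere by blast
  qed
  have in_RP: "critical_values G \<subseteq> RP"
  proof
    fix \<beta> assume "\<beta> \<in> critical_values G"
    then obtain x where x: "x \<in> critical_points G" "\<beta> = span {log_grad G x}"
      by (auto simp: critical_values_def log_gauss_map_eq)
    then show "\<beta> \<in> RP" using crit[of x] by (auto simp: RP_def dim_span dim_singleton)
  qed
  have "A \<in> sets (restrict_space borel (sphere 0 1))"
    using A_borel A_sphere by (auto simp: sets_restrict_space_iff)
  then have meas: "critical_values G \<in> sets RP_algebra"
    using in_RP A_eq unfolding RP_algebra_def
    by (subst sets_measure_of) (auto intro!: sigma_sets.Basic)
  let ?B = "cball (0 :: real ^ 'n) 1 - {0}"
  let ?N = "distr (restrict_space lborel ?B) (restrict_space borel (sphere 0 1)) (sgn :: real ^ 'n \<Rightarrow> _)"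
  have sgn_borel: "(sgn :: real ^ 'n \<Rightarrow> real ^ 'n) \<in> borel_measurable borel"
  proof -
    have "(sgn :: real ^ 'n \<Rightarrow> real ^ 'n) = (\<lambda>x. (1 / norm x) *\<^sub>R x)"
      by (auto simp: sgn_div_norm divide_inverse)
    then show ?thesis by simp
  qed
  have sgn_meas: "sgn \<in> measurable (restrict_space lborel ?B) (restrict_space borel (sphere (0 :: real ^ 'n) 1))"
  proof (rule measurable_restrict_space2)
    show "sgn \<in> space (restrict_space lborel ?B) \<rightarrow> sphere 0 1"
      by (auto simp: space_restrict_space norm_sgn)
    show "sgn \<in> borel_measurable (restrict_space lborel ?B)"
      using sgn_borel by (intro measurable_restrict_space1) simp
  qed
  define T where "T = {y \<in> ?B. sgn y \<in> A}"
  have "T = ?B \<inter> sgn -` A" by (auto simp: T_def)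
  moreover have "sgn -` A \<in> sets borel"
    using measurable_sets[OF sgn_borel A_borel] by simp
  ultimately have T_borel: "T \<in> sets lborel" by auto
  have "T \<subseteq> {s *\<^sub>R log_grad G x | s x. x \<in> critical_points G}"
  proof
    fix y assume "y \<in> T"
    then have y: "y \<noteq> 0" "sgn y \<in> A" by (auto simp: T_def)
    then obtain r x where rx: "x \<in> critical_points G" "sgn y = r *\<^sub>R sgn (log_grad G x)"
      unfolding A_def by blast
    have "y = norm y *\<^sub>R sgn y" using y(1) by (simp add: sgn_div_norm)
    also have "\<dots> = (norm y * (r / norm (log_grad G x))) *\<^sub>R log_grad G x"
      unfolding rx(2) by (simp add: sgn_div_norm divide_inverse)
    finally show "y \<in> {s *\<^sub>R log_grad G x | s x. x \<in> critical_points G}" using rx(1) by blast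
  qed
  then have "negligible T" by (rule negligible_subset[OF negligible_critical_directions])
  then have "emeasure lborel T = 0"
    using T_borel by (simp add: negligible_iff_null_sets null_sets_completion_iff null_setsD1)
  moreover have "emeasure ?N A = emeasure lborel T"
  proof -
    have "emeasure ?N A = emeasure (restrict_space lborel ?B) (sgn -` A \<inter> space (restrict_space lborel ?B))"
      using sgn_meas \<open>A \<in> sets (restrict_space borel (sphere 0 1))\<close> by (rule emeasure_distr)
    also have "sgn -` A \<inter> space (restrict_space lborel ?B) = T"
      by (auto simp: T_def space_restrict_space)
    also have "emeasure (restrict_space lborel ?B) T = emeasure lborel T"
      by (rule emeasure_restrict_space) (auto simp: T_def)
    finally show ?thesis .
  qed
  ultimately have "emeasure (sphere_measure :: (real ^ 'n) measure) A = 0"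
    by (simp add: sphere_measure_def)
  moreover have "(\<lambda>x. span {x}) -` critical_values G \<inter> space sphere_measure = A"
    unfolding space_sphere_measure using A_eq by auto
  ultimately have "emeasure (distr sphere_measure RP_algebra (\<lambda>x. span {x})) (critical_values G) = 0"
    using emeasure_distr[OF measurable_span_RP meas] by simp
  then show ?thesis
    using meas by (auto simp: null_sets_def RP_measure_def)
qed

lemma emeasure_count_space_le_if_finite_subsets_le:
  assumes "\<And>Y. finite Y \<Longrightarrow> Y \<subseteq> X \<Longrightarrow> real (card Y) \<le> b"
  shows "emeasure (count_space UNIV) X \<le> ennreal b"
proof (cases "finite X")
  case True
  then show ?thesis using assms[of X] by (simp add: ennreal_of_nat_eq_real_of_nat ennreal_leI)
next
  case False
  then obtain Y where "finite Y" "card Y = Suc (nat \<lceil>b\<rceil>)" "Y \<subseteq> X"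
    using infinite_arbitrarily_large by blast
  then have "real (Suc (nat \<lceil>b\<rceil>)) \<le> b" using assms by metis
  then show ?thesis by linarith
qed

text \<open>
  The Kushnirenko bound applies to \<open>G\<close> and the polynomials \<open>v\<^sub>j \<theta>\<^sub>i - v\<^sub>i \<theta>\<^sub>j\<close> with \<open>i \<noteq> j\<close>.  If all their
  derivatives at a point \<open>x\<close> of the fibre vanish in the logarithmic direction \<open>w\<close>, then \<open>w\<close> is tangent
  to the hypersurface and the derivative of \<open>\<theta>\<close> along \<open>w\<close> is parallel to \<open>v\<close>, hence to \<open>\<theta>(x)\<close>; so \<open>x\<close>
  would be critical.
\<close>

lemma regular_fibre_card_le:
  fixes G :: "('n::finite, real) mpoly"
  assumes \<beta>: "\<beta> \<in> RP" "\<beta> \<notin> critical_values G"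
    and Y: "finite Y" "Y \<subseteq> {x \<in> real_hypersurface G. log_gauss_map G x = \<beta>}"
  shows "real (card Y) \<le> fact CARD('n) * measure lborel (newton_polytope G)"
proof (cases "Y = {}")
  case True
  then show ?thesis by simp
next
  case False
  let ?S = "Poly_Mapping.keys G" and ?c = "Poly_Mapping.lookup G"
  let ?\<theta> = "log_grad G"
  obtain x1 where x1: "x1 \<in> Y" using False by blast
  define v where "v = ?\<theta> x1"
  have grad: "?\<theta> x \<noteq> 0" "span {?\<theta> x} = \<beta>" if "x \<in> Y" for x
  proof -
    show "span {?\<theta> x} = \<beta>" using Y(2) that by (auto simp: log_gauss_map_eq)
    then have "dim {?\<theta> x} = 1" using \<beta>(1) by (metis (mono_tags) RP_def dim_span mem_Collect_eq)
    then show "?\<theta> x \<noteq> 0" by (auto simp: dim_singleton)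
  qed
  have torus: "x \<in> alg_torus" "mp_eval G x = 0" "x \<notin> critical_points G" if "x \<in> Y" for x
    using Y(2) \<beta>(2) that by (auto simp: real_hypersurface_def critical_values_def)
  have "v \<noteq> 0" using grad(1)[OF x1] by (simp add: v_def)
  then obtain j where j: "v $ j \<noteq> 0" by (auto simp: vec_eq_iff)
  have multiple: "\<exists>r. r \<noteq> 0 \<and> ?\<theta> x = r *\<^sub>R v" if "x \<in> Y" for x
  proof -
    have "?\<theta> x \<in> span {v}" using grad(2)[OF that] grad(2)[OF x1] span_base[of "?\<theta> x" "{?\<theta> x}"]
      by (simp add: v_def)
    then show ?thesis using grad(1)[OF that] by (auto simp: span_singleton)
  qed
  \<comment> \<open>The index \<open>j\<close>, for which \<open>v\<^sub>j \<theta>\<^sub>i - v\<^sub>i \<theta>\<^sub>j\<close> is zero, is used for \<open>G\<close> itself.\<close>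
  define d where "d i a = (if i = j then ?c a else (v $ j * real (a $ i) - v $ i * real (a $ j)) * ?c a)" for i a
  have g_eq: "poly_fn ?S (d i) x = (if i = j then mp_eval G x else v $ j * ?\<theta> x $ i - v $ i * ?\<theta> x $ j)" for i x
    by (simp add: d_def[abs_def] mp_eval_eq_poly_fn log_grad_def poly_fn_linear_combination)
  obtain \<alpha> where "\<alpha> \<in> ?S"
  proof -
    have "?S \<noteq> {}" using grad(1)[OF x1] by (auto simp: log_grad_def poly_fn_def vec_eq_iff)
    then show ?thesis using that by blast
  qed
  show ?thesis
  proof (rule nondegenerate_zeros_le_normalized_volume[where g = "\<lambda>i. poly_fn ?S (d i)" and \<alpha> = \<alpha>
      and g' = "\<lambda>x i u. \<Sum>k\<in>UNIV. u $ k / x $ k * poly_fn ?S (\<lambda>a. real (a $ k) * d i a) x"])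
    show "compact (newton_polytope G)" unfolding newton_polytope_def
      by (intro finite_imp_compact_convex_hull finite_imageI finite_keys)
    show "convex (newton_polytope G)" unfolding newton_polytope_def by (rule convex_convex_hull)
    show "exponent_point \<alpha> \<in> newton_polytope G" unfolding newton_polytope_def
      using \<open>\<alpha> \<in> ?S\<close> by (intro hull_inc) simp
    show "poly_fn ?S (d i) \<in> polys_in (newton_polytope G)" for i
      unfolding polys_in_def newton_polytope_def poly_fn_def[abs_def]
      by (intro CollectI exI[of _ ?S] exI[of _ "d i"]) (auto intro: hull_inc)
    show "finite Y" by fact
    show "Y \<subseteq> alg_torus" using torus by blast
    show "poly_fn ?S (d i) x = 0" if x: "x \<in> Y" for i x
      using multiple[OF x] torus(2)[OF x] by (auto simp: g_eq)
    show "(poly_fn ?S (d i) has_derivative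
        (\<lambda>u. \<Sum>k\<in>UNIV. u $ k / x $ k * poly_fn ?S (\<lambda>a. real (a $ k) * d i a) x)) (at x)" if "x \<in> Y" for i x
      by (rule poly_fn_has_derivative[OF torus(1)[OF that]])
    show "\<exists>i. (\<Sum>k\<in>UNIV. u $ k / x $ k * poly_fn ?S (\<lambda>a. real (a $ k) * d i a) x) \<noteq> 0"
      if x: "x \<in> Y" and u: "u \<noteq> 0" for x u
    proof (rule ccontr)
      define w where "w = (\<chi> k. u $ k / x $ k)"
      assume "\<nexists>i. (\<Sum>k\<in>UNIV. u $ k / x $ k * poly_fn ?S (\<lambda>a. real (a $ k) * d i a) x) \<noteq> 0"
      then have zero: "(\<Sum>k\<in>UNIV. w $ k * poly_fn ?S (\<lambda>a. real (a $ k) * d i a) x) = 0" for i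
        by (simp add: w_def)
      have "w \<noteq> 0" using u torus(1)[OF x] by (auto simp: w_def vec_eq_iff alg_torus_def)
      moreover have "w \<bullet> ?\<theta> x = 0"
        using zero[of j] by (simp add: d_def[abs_def] inner_vec_def log_grad_def)
      moreover have "\<exists>l. log_hess G x w = l *\<^sub>R ?\<theta> x"
      proof -
        let ?Q = "log_hess G x w"
        obtain r where r: "r \<noteq> 0" "?\<theta> x = r *\<^sub>R v" using multiple[OF x] by blast
        have Q: "v $ j * ?Q $ i = v $ i * ?Q $ j" for i
        proof (cases "i = j")
          case False
          have "poly_fn ?S (\<lambda>a. real (a $ k) * d i a) x
              = v $ j * poly_fn ?S (\<lambda>a. real (a $ k) * (real (a $ i) * ?c a)) x
                - v $ i * poly_fn ?S (\<lambda>a. real (a $ k) * (real (a $ j) * ?c a)) x" for k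
            using False poly_fn_linear_combination[of ?S "v $ j" "\<lambda>a. real (a $ i)" "v $ i" "\<lambda>a. real (a $ j)"
                "\<lambda>a. real (a $ k) * ?c a" x]
            by (simp add: d_def mult_ac)
          then have "v $ j * ?Q $ i - v $ i * ?Q $ j
              = (\<Sum>k\<in>UNIV. w $ k * poly_fn ?S (\<lambda>a. real (a $ k) * d i a) x)"
            by (simp add: log_hess_def sum_distrib_left sum_subtractf right_diff_distrib mult_ac)
          then show ?thesis using zero[of i] by simp
        qed simp
        have component: "?Q $ i = (?Q $ j / v $ j / r) * ?\<theta> x $ i" for i
          using Q[of i] j r by (simp add: field_simps)
        have "?Q = (?Q $ j / v $ j / r) *\<^sub>R ?\<theta> x"
          unfolding vec_eq_iff vector_scaleR_component real_scaleR_def by (intro allI component)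
        then show ?thesis by blast
      qed
      moreover have "x \<in> real_hypersurface G" using Y(2) x by blast
      ultimately have "x \<in> critical_points G"
        using grad(1)[OF x] unfolding critical_points_def by blast
      then show False using torus(3)[OF x] by simp
    qed
  qed
qed

theorem real_amoeba_total_curvature_le:
  fixes G :: "('n::finite, real) mpoly"
  shows "real_amoeba_total_curvature G \<le>
    ennreal (fact CARD('n) * measure lborel (newton_polytope G)) * ennreal (sphere_vol (CARD('n) - 1) / 2)"
proof -
  let ?b = "ennreal (fact CARD('n) * measure lborel (newton_polytope G))"
  let ?fibre = "\<lambda>\<beta>. {x \<in> real_hypersurface G. log_gauss_map G x = \<beta>}"
  have "AE \<beta> in RP_measure. \<beta> \<notin> critical_values G" by (rule AE_not_in[OF critical_values_null])
  then have "AE \<beta> in RP_measure. emeasure (count_space UNIV) (?fibre \<beta>) \<le> ?b"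
    using AE_space
  proof eventually_elim
    case (elim \<beta>)
    then show ?case
      by (intro emeasure_count_space_le_if_finite_subsets_le regular_fibre_card_le)
         (auto simp: space_RP_measure)
  qed
  then have "real_amoeba_total_curvature G \<le> (\<integral>\<^sup>+ \<beta>. ?b \<partial>(RP_measure :: (real ^ 'n) set measure))"
    unfolding real_amoeba_total_curvature_def by (rule nn_integral_mono_AE)
  also have "\<dots> = ?b * emeasure (RP_measure :: (real ^ 'n) set measure) RP"
    by (simp only: nn_integral_const space_RP_measure)
  finally show ?thesis by (simp only: emeasure_RP_measure_space)
qed

lemma newton_polytope_mp_at_subset:
  "newton_polytope (mp_at F t) \<subseteq> trop_newton_polytope (Trop F)"
proof -
  have "Poly_Mapping.keys (mp_at F t) \<subseteq> dom (Trop F)"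
    by (auto simp: mp_at_def Trop_def in_keys_iff Poly_Mapping.map.rep_eq when_def split: if_splits)
  then show ?thesis unfolding newton_polytope_def trop_newton_polytope_def
    by (intro hull_mono image_mono)
qed

lemma real_trop_total_curvature_le:
  fixes F :: "('n::finite, real gpuiseux) mpoly"
  shows "real_trop_total_curvature F \<le>
    ennreal (fact CARD('n) * measure lborel (trop_newton_polytope (Trop F))) * ennreal (sphere_vol (CARD('n) - 1) / 2)"
  unfolding real_trop_total_curvature_def
proof (rule Limsup_bounded, rule always_eventually, rule allI)
  fix t
  have "dom (Trop F) = Poly_Mapping.keys F" by (auto simp: Trop_def in_keys_iff split: if_splits)
  then have "compact (trop_newton_polytope (Trop F))" unfolding trop_newton_polytope_def
    by (intro finite_imp_compact_convex_hull) simp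
  moreover have "compact (newton_polytope (mp_at F t))" unfolding newton_polytope_def
    by (intro finite_imp_compact_convex_hull) simp
  ultimately have "measure lborel (newton_polytope (mp_at F t)) \<le> measure lborel (trop_newton_polytope (Trop F))"
    by (intro measure_mono_fmeasurable newton_polytope_mp_at_subset fmeasurable_compact) (simp add: borel_compact)
  then have "ennreal (fact CARD('n) * measure lborel (newton_polytope (mp_at F t)))
      \<le> ennreal (fact CARD('n) * measure lborel (trop_newton_polytope (Trop F)))"
    by (intro ennreal_leI mult_left_mono) auto
  then show "real_amoeba_total_curvature (mp_at F t) \<le> ennreal (fact CARD('n) * measure lborel (trop_newton_polytope (Trop F)))
      * ennreal (sphere_vol (CARD('n) - 1) / 2)"
    by (intro order_trans[OF real_amoeba_total_curvature_le] mult_right_mono) auto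
qed

lemma sphere_vol_pos: "0 < sphere_vol m"
  by (simp add: sphere_vol_def)

theorem theorem4p6:
  fixes n :: nat
    and F :: "('n::finite, real gpuiseux) mpoly"
    and f :: "'n trop_poly"
  assumes "n \<ge> 1"
    and "CARD('n) = n + 1"
    and "\<forall>\<^sub>F t in at_right 0. completely_nondegenerate (mp_complexify (mp_at F t))"
    and "f = Trop F"
  shows "ennreal (sphere_vol (2 * n) / sphere_vol n) * real_trop_total_curvature F
           \<le> ennreal (trop_total_abs_curvature f)"
proof -
  define V where "V = fact (n + 1) * measure lborel (trop_newton_polytope f)"
  have "0 \<le> V" by (simp add: V_def)
  have "ennreal (sphere_vol (2 * n) / sphere_vol n) * real_trop_total_curvature F
      \<le> ennreal (sphere_vol (2 * n) / sphere_vol n) * (ennreal V * ennreal (sphere_vol n / 2))"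
    using real_trop_total_curvature_le[of F] assms(2,4) unfolding V_def by (intro mult_left_mono) auto
  also have "\<dots> = ennreal (sphere_vol (2 * n) / sphere_vol n * (V * (sphere_vol n / 2)))"
    using sphere_vol_pos[of n] sphere_vol_pos[of "2 * n"] \<open>0 \<le> V\<close>
    by (simp flip: ennreal_mult)
  also have "sphere_vol (2 * n) / sphere_vol n * (V * (sphere_vol n / 2)) = trop_total_abs_curvature f"
  proof -
    have "trop_total_abs_curvature f = ((-1) ^ n * (-1) ^ n) * curv_const n * V * CP_vol n"
      using assms(2) by (simp add: trop_total_abs_curvature_def trop_total_curvature_def Let_def V_def mult_ac)
    also have "\<dots> = curv_const n * V * CP_vol n" by (simp flip: power_mult_distrib)
    also have "\<dots> = sphere_vol (2 * n) / 2 * V"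
      using sphere_vol_pos[of "2 * n + 1"]
      by (simp add: curv_const_def CP_vol_def sphere_vol_1[unfolded One_nat_def])
    finally show ?thesis using sphere_vol_pos[of n] by simp
  qed
  finally show ?thesis .
qed

end
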